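(* Let $\mathcal{G}=(V,\mathcal{E})$ be a tree with bounded degree, endowed with a weight function $a$ which makes it a transient weighted graph, and let $x\in V$ be a fixed site. Consider the function $f_x:V\to[0,\infty)$ given by $$f_x(z)=P_z\big[d(X_n,x)>d(z,x)\text{ for every }n>0\big]\cdot\mu_z\cdot P_z\big[d(X_n,x)\ge d(z,x)\text{ for every }n\ge0\big].$$ Then, for every $u\ge0$, the cluster of $\mathcal{V}^u$ containing $x$ in the interlacement process has the same law as the open cluster containing $x$ for the Bernoulli independent site percolation on $V$ characterized by $P[z\text{ is open}]=\exp(-u\cdot f_x(z))$, $z\in V$. In particular, if in addition the degree of each vertex of the tree is larger than or equal to three and the weights are bounded from above and from below (there are constants $0<m\le M<\infty$ with $m\le a_{y,z}\le M$ for every edge $\{y,z\}\in\mathcal{E}$), then the critical value $u_*$ for percolation of the vacant set of random interlacements on $\mathcal{G}$ is non-degenerate, i.e. $$0<u_*<\infty .$$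
   Context: Weighted graphs. $\mathcal{G}=(V,\mathcal{E})$ is connected, $V$ is countable and $\mathcal{E}\subset\{\{x,y\}\subset V;\ x\neq y\}$; $d(\cdot,\cdot)$ is the graph distance, and the degree of a vertex is the number of edges incident to it. A weight function is a symmetric map $a:V\times V\to\mathbb{R}_+$ with $a_{x,y}>0$ iff $\{x,y\}\in\mathcal{E}$. Put $\mu_x=\sum_{y:\{x,y\}\in\mathcal{E}}a_{x,y}$. $P_x$ is the law of the random walk $(X_n)_{n\ge0}$ started at $x$ with transition probabilities $a_{x,y}/\mu_x$; the weighted graph is transient if this walk is transient. Capacity. For finite $K\subset V$, $\mathrm{cap}(K)=\inf\{\frac12\sum_{x,y\in V}|f(x)-f(y)|^2a_{x,y};\ f:V\to\mathbb{R}\text{ finitely supported},\ f\equiv1\text{ on }K\}$. With $\widetilde H_K=\inf\{n\ge1;X_n\in K\}$ and $e_K(x)=1_{\{x\in K\}}P_x[\widetilde H_K=\infty]\mu_x$, one has $\mathrm{cap}(K)=\sum_{x\in K}e_K(x)$. Random interlacements. $W_+$ (resp. $W$) is the set of nearest-neighbor trajectories indexed by $\mathbb{N}=\{0,1,\dots\}$ (resp. $\mathbb{Z}$) that visit each vertex only finitely many times, with the $\sigma$-algebra generated by the canonical coordinates $X_n$. $W^*$ is the quotient of $W$ by time shift, with projection $\pi^*$ and the $\sigma$-algebra $\{A;(\pi^* )^{-1}(A)\text{ measurable}\}$; $W_K$ is the set of $w\in W$ entering $K$, and $W_K^*=\pi^*(W_K)$. There is a unique $\sigma$-finite measure $\nu$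 on $W^*$ such that for each finite $K\subset V$, $1_{W_K^*}\cdot\nu$ is the image under $\pi^*$ of the measure $Q_K$ on $W_K$ given by $Q_K[(X_{-n})_{n\ge0}\in A,X_0=x,(X_n)_{n\ge0}\in B]=P_x[A\mid\widetilde H_K=\infty]\,e_K(x)\,P_x[B]$ for measurable $A,B\subset W_+$ and $x\in V$. Let $\mathbb{P}$ be the law of a Poisson point process $\omega=\sum_i\delta_{(w_i^*,u_i)}$ on $W^*\times\mathbb{R}_+$ with intensity $\nu(dw^* )\otimes du$. The vacant set at level $u\ge0$ is $\mathcal{V}^u=V\setminus\bigcup_{i:u_i\le u}\mathrm{Range}(w_i^* )$. The law $Q^u$ of $(1_{\{x\in\mathcal{V}^u\}})_{x\in V}$ on $\{0,1\}^V$ (with the $\sigma$-algebra generated by the coordinates $Y_x$) is the unique probability measure such that $Q^u[Y_x=1\text{ for all }x\in K]=\exp(-u\cdot\mathrm{cap}(K))$ for all finite $K\subset V$. Clusters. The cluster containing $x$ of a random set of sites ($\mathcal{V}^u$, or the set of open sites) is the connected component of $x$ in the induced subgraph (empty if $x$ is not in the set), viewed as a random element of $\{0,1\}^V$. In Bernoulli independent site percolation the sites are open independently of each other, with the indicated probabilities. Critical value. $\eta(u,x)=\mathbb{P}[\text{the cluster containing }x\text{ in }\mathcal{V}^u\text{ is infinite}]$ and $u_*=\inf\{u\ge0;\eta(u,x)=0\}\in[0,\infty]$, which does not depend on $x\in V$. *)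

theory Defs
  imports "HOL-Probability.Probability"
begin

subsection \<open>Weighted graphs\<close>

text \<open>The vertex set is the whole countable type \<^typ>\<open>'v\<close>; edges are unordered pairs.\<close>

definition is_graph :: "'v set set \<Rightarrow> bool" where
  "is_graph E \<longleftrightarrow> (\<forall>e\<in>E. \<exists>x y. x \<noteq> y \<and> e = {x, y})"

definition adj :: "'v set set \<Rightarrow> 'v \<Rightarrow> 'v \<Rightarrow> bool" where
  "adj E x y \<longleftrightarrow> {x, y} \<in> E"

definition graph_connected :: "'v set set \<Rightarrow> bool" where
  "graph_connected E \<longleftrightarrow> (\<forall>x y. (adj E)\<^sup>*\<^sup>* x y)"

definition is_cycle :: "'v set set \<Rightarrow> 'v list \<Rightarrow> bool" where
  "is_cycle E c \<longleftrightarrow>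
     3 \<le> length c \<and> distinct c \<and> successively (adj E) c \<and> adj E (last c) (hd c)"

definition is_tree :: "'v set set \<Rightarrow> bool" where
  "is_tree E \<longleftrightarrow> is_graph E \<and> graph_connected E \<and> (\<nexists>c. is_cycle E c)"

definition graph_dist :: "'v set set \<Rightarrow> 'v \<Rightarrow> 'v \<Rightarrow> nat" where
  "graph_dist E x y = (LEAST n. (adj E ^^ n) x y)"

definition vertex_degree :: "'v set set \<Rightarrow> 'v \<Rightarrow> nat" where
  "vertex_degree E x = card {e \<in> E. x \<in> e}"

text \<open>Finiteness is explicit because \<^const>\<open>card\<close> of an infinite set is 0.\<close>

definition bounded_degree :: "'v set set \<Rightarrow> bool" where
  "bounded_degree E \<longleftrightarrow> (\<exists>D. \<forall>x. finite {e \<in> E. x \<in> e} \<and> vertex_degree E x \<le> D)"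

definition is_weight :: "'v set set \<Rightarrow> ('v \<Rightarrow> 'v \<Rightarrow> real) \<Rightarrow> bool" where
  "is_weight E a \<longleftrightarrow>
     (\<forall>x y. a x y = a y x \<and> 0 \<le> a x y \<and> (0 < a x y \<longleftrightarrow> {x, y} \<in> E))"

definition vertex_weight :: "'v set set \<Rightarrow> ('v \<Rightarrow> 'v \<Rightarrow> real) \<Rightarrow> 'v \<Rightarrow> real" where
  "vertex_weight E a x = (\<Sum>y | {x, y} \<in> E. a x y)"


subsection \<open>Random walk\<close>

text \<open>
  On a graph with a single vertex the weights are 0 and \<open>embed_pmf\<close> can only be the point mass,
  so the walk stays put and the graph is not transient.
\<close>

definition walk_step :: "'v set set \<Rightarrow> ('v \<Rightarrow> 'v \<Rightarrow> real) \<Rightarrow> 'v \<Rightarrow> 'v pmf" where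
  "walk_step E a y = embed_pmf (\<lambda>z. a y z / vertex_weight E a y)"

definition walk_kernel ::
  "'v set set \<Rightarrow> ('v \<Rightarrow> 'v \<Rightarrow> real) \<Rightarrow> 'v \<Rightarrow> nat \<Rightarrow> (nat \<Rightarrow> 'v) \<Rightarrow> 'v measure" where
  "walk_kernel E a x n w =
     (case n of 0 \<Rightarrow> measure_pmf (return_pmf x) | Suc k \<Rightarrow> measure_pmf (walk_step E a (w k)))"

text \<open>
  The law of the walk started at \<open>x\<close>, on the product \<open>\<sigma>\<close>-algebra of \<open>nat \<Rightarrow> 'v\<close>: the
  Ionescu-Tulcea measure whose coordinate 0 is \<open>x\<close> and whose coordinate \<open>k + 1\<close>
  is drawn from \<open>walk_step\<close> at coordinate \<open>k\<close>.
\<close>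

definition walk_law ::
  "'v set set \<Rightarrow> ('v \<Rightarrow> 'v \<Rightarrow> real) \<Rightarrow> 'v \<Rightarrow> (nat \<Rightarrow> 'v) measure" where
  "walk_law E a x =
     projective_family.lim UNIV
       (Ionescu_Tulcea.CI (walk_kernel E a x) (\<lambda>_. count_space UNIV)) (\<lambda>_. count_space UNIV)"

text \<open>The event that the hitting time of \<open>K\<close> at positive times is infinite.\<close>

definition no_return :: "'v set \<Rightarrow> (nat \<Rightarrow> 'v) \<Rightarrow> bool" where
  "no_return K w \<longleftrightarrow> (\<forall>n\<ge>1. w n \<notin> K)"

definition transient :: "'v set set \<Rightarrow> ('v \<Rightarrow> 'v \<Rightarrow> real) \<Rightarrow> bool" where
  "transient E a \<longleftrightarrow> (\<forall>x. 0 < \<P>(w in walk_law E a x. no_return {x} w))"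

definition equilibrium_measure ::
  "'v set set \<Rightarrow> ('v \<Rightarrow> 'v \<Rightarrow> real) \<Rightarrow> 'v set \<Rightarrow> 'v \<Rightarrow> real" where
  "equilibrium_measure E a K x =
     indicator K x * \<P>(w in walk_law E a x. no_return K w) * vertex_weight E a x"


subsection \<open>Trajectories modulo time shift\<close>

definition half_trajectories :: "'v set set \<Rightarrow> (nat \<Rightarrow> 'v) set" where
  "half_trajectories E =
     {w. (\<forall>n. {w n, w (n + 1)} \<in> E) \<and> (\<forall>x. finite {n. w n = x})}"

definition half_trajectory_space :: "'v set set \<Rightarrow> (nat \<Rightarrow> 'v) measure" where
  "half_trajectory_space E =
     restrict_space (\<Pi>\<^sub>M n\<in>UNIV. count_space UNIV) (half_trajectories E)"

definition trajectories :: "'v set set \<Rightarrow> (int \<Rightarrow> 'v) set" where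
  "trajectories E =
     {w. (\<forall>n. {w n, w (n + 1)} \<in> E) \<and> (\<forall>x. finite {n. w n = x})}"

definition trajectory_space :: "'v set set \<Rightarrow> (int \<Rightarrow> 'v) measure" where
  "trajectory_space E =
     restrict_space (\<Pi>\<^sub>M n\<in>UNIV. count_space UNIV) (trajectories E)"

definition shift_rel :: "'v set set \<Rightarrow> ((int \<Rightarrow> 'v) \<times> (int \<Rightarrow> 'v)) set" where
  "shift_rel E =
     {(w, w'). w \<in> trajectories E \<and> w' \<in> trajectories E \<and> (\<exists>k. \<forall>n. w' n = w (n + k))}"

definition shift_class :: "'v set set \<Rightarrow> (int \<Rightarrow> 'v) \<Rightarrow> (int \<Rightarrow> 'v) set" where
  "shift_class E w = shift_rel E `` {w}"

text \<open>The generating family is already a \<open>\<sigma>\<close>-algebra.\<close>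

definition trajectory_class_space :: "'v set set \<Rightarrow> (int \<Rightarrow> 'v) set measure" where
  "trajectory_class_space E =
     sigma (trajectories E // shift_rel E)
       {A. A \<subseteq> trajectories E // shift_rel E \<and>
           {w \<in> trajectories E. shift_class E w \<in> A} \<in> sets (trajectory_space E)}"

definition trajectories_hitting :: "'v set set \<Rightarrow> 'v set \<Rightarrow> (int \<Rightarrow> 'v) set" where
  "trajectories_hitting E K = {w \<in> trajectories E. \<exists>n. w n \<in> K}"

definition class_range :: "(int \<Rightarrow> 'v) set \<Rightarrow> 'v set" where
  "class_range c = (\<Union>w\<in>c. range w)"


subsection \<open>Random interlacements\<close>

definition is_Q ::
  "'v set set \<Rightarrow> ('v \<Rightarrow> 'v \<Rightarrow> real) \<Rightarrow> 'v set \<Rightarrow> (int \<Rightarrow> 'v) measure \<Rightarrow> bool" where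
  "is_Q E a K Q \<longleftrightarrow>
     sets Q = sets (restrict_space (trajectory_space E) (trajectories_hitting E K)) \<and>
     (\<forall>A \<in> sets (half_trajectory_space E). \<forall>B \<in> sets (half_trajectory_space E). \<forall>x.
        emeasure Q {w \<in> trajectories_hitting E K.
            (\<lambda>n::nat. w (- int n)) \<in> A \<and> w 0 = x \<and> (\<lambda>n::nat. w (int n)) \<in> B} =
        ennreal (\<P>(w in walk_law E a x. w \<in> A \<bar> no_return K w)
                 * equilibrium_measure E a K x
                 * \<P>(w in walk_law E a x. w \<in> B)))"

text \<open>
  The defining property of \<open>\<nu>\<close>. The measure \<open>Q\<close> below is determined by \<open>K\<close>, since the events
  in \<open>is_Q\<close> form an intersection-stable generator of the \<open>\<sigma>\<close>-algebra.
\<close>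

definition interlacement_intensity ::
  "'v set set \<Rightarrow> ('v \<Rightarrow> 'v \<Rightarrow> real) \<Rightarrow> (int \<Rightarrow> 'v) set measure \<Rightarrow> bool" where
  "interlacement_intensity E a \<nu> \<longleftrightarrow>
     sets \<nu> = sets (trajectory_class_space E) \<and> sigma_finite_measure \<nu> \<and>
     (\<forall>K. finite K \<longrightarrow> (\<exists>Q. is_Q E a K Q \<and>
        density \<nu> (indicator (shift_class E ` trajectories_hitting E K)) =
        distr Q (trajectory_class_space E) (shift_class E)))"

text \<open>
  A point measure \<open>\<Sum>\<^sub>i \<delta>(p\<^sub>i)\<close> is encoded by its multiplicity function
  \<open>\<omega> p = card {i. p\<^sub>i = p}\<close>.
\<close>

definition point_count :: "('p \<Rightarrow> nat) \<Rightarrow> 'p set \<Rightarrow> ennreal" where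
  "point_count \<omega> A = (\<integral>\<^sup>+ p. of_nat (\<omega> p) \<partial>count_space A)"

text \<open>With \<open>0 ^ 0 = 1\<close> the formula below also covers sets of intensity 0.\<close>

definition poisson_point_process ::
  "'o measure \<Rightarrow> 'p measure \<Rightarrow> ('o \<Rightarrow> 'p \<Rightarrow> nat) \<Rightarrow> bool" where
  "poisson_point_process M I \<omega> \<longleftrightarrow>
     prob_space M \<and>
     (\<forall>\<xi>\<in>space M. countable {p. 0 < \<omega> \<xi> p} \<and> {p. 0 < \<omega> \<xi> p} \<subseteq> space I) \<and>
     (\<forall>A\<in>sets I. (\<lambda>\<xi>. point_count (\<omega> \<xi>) A) \<in> borel_measurable M) \<and>
     (\<forall>A\<in>sets I. emeasure I A < \<infinity> \<longrightarrow>
        (\<forall>k::nat. \<P>(\<xi> in M. point_count (\<omega> \<xi>) A = of_nat k) =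
           exp (- measure I A) * measure I A ^ k / fact k)) \<and>
     (\<forall>F. finite F \<and> F \<subseteq> sets I \<and> disjoint F \<longrightarrow>
        prob_space.indep_vars M (\<lambda>_. borel) (\<lambda>A \<xi>. point_count (\<omega> \<xi>) A) F)"

definition interlacement_process ::
  "'v set set \<Rightarrow> ('v \<Rightarrow> 'v \<Rightarrow> real) \<Rightarrow> 'o measure
    \<Rightarrow> ('o \<Rightarrow> (int \<Rightarrow> 'v) set \<times> real \<Rightarrow> nat) \<Rightarrow> bool" where
  "interlacement_process E a M \<omega> \<longleftrightarrow>
     (\<exists>\<nu>. interlacement_intensity E a \<nu> \<and>
        poisson_point_process M (\<nu> \<Otimes>\<^sub>M restrict_space lborel {0..}) \<omega>)"

definition vacant_set :: "((int \<Rightarrow> 'v) set \<times> real \<Rightarrow> nat) \<Rightarrow> real \<Rightarrow> 'v set" where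
  "vacant_set \<omega> u = UNIV - (\<Union>(c, t) \<in> {(c, t). 0 < \<omega> (c, t) \<and> t \<le> u}. class_range c)"


subsection \<open>Clusters and percolation\<close>

definition cluster :: "'v set set \<Rightarrow> 'v set \<Rightarrow> 'v \<Rightarrow> 'v set" where
  "cluster E S x = {y. x \<in> S \<and> (\<lambda>y z. y \<in> S \<and> z \<in> S \<and> {y, z} \<in> E)\<^sup>*\<^sup>* x y}"

text \<open>Site configurations \<open>{0,1}\<^sup>V\<close>, with \<^const>\<open>True\<close> for 1.\<close>

abbreviation site_space :: "('v \<Rightarrow> bool) measure" where
  "site_space \<equiv> \<Pi>\<^sub>M z\<in>UNIV. count_space UNIV"

definition vacant_cluster_law ::
  "'v set set \<Rightarrow> 'o measure \<Rightarrow> ('o \<Rightarrow> (int \<Rightarrow> 'v) set \<times> real \<Rightarrow> nat)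
    \<Rightarrow> real \<Rightarrow> 'v \<Rightarrow> ('v \<Rightarrow> bool) measure" where
  "vacant_cluster_law E M \<omega> u x =
     distr M site_space (\<lambda>\<xi> z. z \<in> cluster E (vacant_set (\<omega> \<xi>) u) x)"

definition bernoulli_site_percolation :: "('v \<Rightarrow> real) \<Rightarrow> ('v \<Rightarrow> bool) measure" where
  "bernoulli_site_percolation p = (\<Pi>\<^sub>M z\<in>UNIV. measure_pmf (bernoulli_pmf (p z)))"

definition open_cluster_law ::
  "'v set set \<Rightarrow> ('v \<Rightarrow> real) \<Rightarrow> 'v \<Rightarrow> ('v \<Rightarrow> bool) measure" where
  "open_cluster_law E p x =
     distr (bernoulli_site_percolation p) site_space (\<lambda>Y z. z \<in> cluster E {y. Y y} x)"

definition f_fun ::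
  "'v set set \<Rightarrow> ('v \<Rightarrow> 'v \<Rightarrow> real) \<Rightarrow> 'v \<Rightarrow> 'v \<Rightarrow> real" where
  "f_fun E a x z =
     \<P>(w in walk_law E a z. \<forall>n>0. graph_dist E (w n) x > graph_dist E z x)
     * vertex_weight E a z
     * \<P>(w in walk_law E a z. \<forall>n. graph_dist E (w n) x \<ge> graph_dist E z x)"

definition percolation_prob ::
  "'v set set \<Rightarrow> 'o measure \<Rightarrow> ('o \<Rightarrow> (int \<Rightarrow> 'v) set \<times> real \<Rightarrow> nat)
    \<Rightarrow> real \<Rightarrow> 'v \<Rightarrow> real" where
  "percolation_prob E M \<omega> u x = \<P>(\<xi> in M. infinite (cluster E (vacant_set (\<omega> \<xi>) u) x))"

definition critical_value ::
  "'v set set \<Rightarrow> 'o measure \<Rightarrow> ('o \<Rightarrow> (int \<Rightarrow> 'v) set \<times> real \<Rightarrow> nat) \<Rightarrow> 'v \<Rightarrow> ereal" where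
  "critical_value E M \<omega> x = Inf {ereal u | u. 0 \<le> u \<and> percolation_prob E M \<omega> u x = 0}"

end

theory Submission
  imports Defs
begin

text \<open>
The vacant set at level \<open>u\<close> contains a finite set \<open>K\<close> iff the Poisson process puts no point on
(trajectories hitting \<open>K\<close>) \<open>\<times> [0, u]\<close>. The \<open>\<nu>\<close>-mass of the trajectories hitting \<open>K\<close> is the total
mass of \<open>Q\<^sub>K\<close>, that is \<open>\<Sum>z\<in>K. e\<^sub>K(z)\<close>, because a transient walk almost surely belongs to
\<open>W\<^sub>+\<close>. Hence \<open>K\<close> is vacant with probability \<open>exp(- u \<Sum>z\<in>K. e\<^sub>K(z))\<close> (\<open>vacant_prob\<close>).

On a tree rooted at \<open>x\<close>, the cluster of \<open>x\<close> contains \<open>z\<close> iff all ancestors of \<open>z\<close> are in the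
random set. So the cluster contains a finite set iff the random set contains the subtree \<open>H\<close>
spanned by that set and \<open>x\<close>, and events of this kind determine the law of the cluster. Everything
reduces to \<open>\<Sum>z\<in>H. e\<^sub>H(z) = \<Sum>z\<in>H. f\<^sub>x(z)\<close> for finite subtrees \<open>H\<close> containing \<open>x\<close>
(\<open>capacity_eq_sum_f\<close>), which makes the vacancy probability of \<open>H\<close> a product over its vertices.
Let \<open>h(c)\<close> be the probability that the walk from \<open>c\<close> never visits the parent of \<open>c\<close>, and attach to
the edge from \<open>z\<close> to its child \<open>c\<close> the number \<open>F(c) = a\<^sub>z\<^sub>,\<^sub>c h(c)\<close>. The first step of the walk
gives \<open>e\<^sub>H(z) = \<Sum>F(c)\<close> over the children \<open>c \<notin> H\<close> of \<open>z\<close>, and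
\<open>f\<^sub>x(z) = \<Sum>F(c) - F(z)\<close> with the sum over all children and \<open>F(x) = 0\<close>. The second identity
compares the last visit to \<open>z\<close> with the first visit to its parent (\<open>h_q_balance\<close>). Summation over
\<open>H\<close> telescopes.

For the critical value, bounded weights and degrees between 3 and \<open>D\<close> give
\<open>0 < c \<le> f\<^sub>x \<le> C < \<infinity>\<close>. The upper bound is trivial; the lower one comes from an explicit
positive superharmonic function that bounds the probability of hitting the parent
(\<open>potential_superharmonic\<close>). Then for large \<open>u\<close> the expected number of vertices of the open cluster
at depth \<open>n\<close> tends to 0 (\<open>subcritical_percolation\<close>), while for small \<open>u\<close> every site is open with
probability at least \<open>2/3\<close>, and the recursion over two children of each vertex keeps the probability
of an open descending path of length \<open>n\<close> above \<open>1/2\<close> (\<open>supercritical_percolation\<close>).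
\<close>

section \<open>The walk as a Markov chain\<close>

abbreviation path_space :: "(nat \<Rightarrow> 'v) measure" where
  "path_space \<equiv> \<Pi>\<^sub>M n\<in>UNIV. count_space UNIV"

text \<open>
Over a countable state space the cylinders of initial segments form, together with the empty set, an
intersection-stable generator: two of them are either nested or disjoint.
\<close>

definition path_cylinder :: "'v list \<Rightarrow> (nat \<Rightarrow> 'v) set" where
  "path_cylinder l = {w. \<forall>i<length l. w i = l ! i}"

lemma path_cylinder_sets [measurable]: "path_cylinder (l :: 'v::countable list) \<in> sets path_space"
proof -
  have "{w \<in> space path_space. \<forall>i<length l. w i = l ! i} \<in> sets (path_space :: (nat \<Rightarrow> 'v) measure)"
    by measurable
  then show ?thesis by (simp add: path_cylinder_def space_PiM)
qed

lemma path_cylinder_Int: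
  assumes "length l \<le> length l'"
  shows "path_cylinder l \<inter> path_cylinder l' = path_cylinder l' \<or> path_cylinder l \<inter> path_cylinder l' = {}"
proof (cases "\<forall>i<length l. l ! i = l' ! i")
  case True
  then show ?thesis using assms by (force simp: path_cylinder_def)
next
  case False
  then show ?thesis using assms by (force simp: path_cylinder_def)
qed

lemma path_measure_eqI:
  fixes N N' :: "(nat \<Rightarrow> 'v::countable) measure"
  assumes "prob_space N" and N: "sets N = sets path_space" and N': "sets N' = sets path_space"
    and eq: "\<And>l. emeasure N (path_cylinder l) = emeasure N' (path_cylinder l)"
  shows "N = N'"
proof -
  interpret prob_space N by fact
  let ?G = "insert {} (range path_cylinder) :: (nat \<Rightarrow> 'v) set set"
  have *: "{w. w i \<in> A} \<in> sigma_sets UNIV ?G" for i and A :: "'v set"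
  proof -
    have "{w. w i \<in> A} = (\<Union>l\<in>{l. length l = Suc i \<and> l ! i \<in> A}. path_cylinder l)"
    proof (intro equalityI subsetI)
      fix w :: "nat \<Rightarrow> 'v" assume "w \<in> {w. w i \<in> A}"
      then show "w \<in> (\<Union>l\<in>{l. length l = Suc i \<and> l ! i \<in> A}. path_cylinder l)"
        by (intro UN_I[of "map w [0..<Suc i]"])
          (auto simp: path_cylinder_def nth_append less_Suc_eq simp del: upt_Suc)
    qed (auto simp: path_cylinder_def)
    also have "\<dots> \<in> sigma_sets UNIV ?G"
      by (intro sigma_sets_UNION) (auto intro: sigma_sets.Basic)
    finally show ?thesis .
  qed
  have sets: "sets (path_space :: (nat \<Rightarrow> 'v) measure) = sigma_sets UNIV ?G"
  proof
    show "sets (path_space :: (nat \<Rightarrow> 'v) measure) \<subseteq> sigma_sets UNIV ?G"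
    proof -
      have "{{f \<in> UNIV \<rightarrow>\<^sub>E space (count_space UNIV). f i \<in> A} |i A.
          i \<in> UNIV \<and> A \<in> sets (count_space (UNIV :: 'v set))} \<subseteq> sigma_sets UNIV ?G"
        using * by (intro subsetI) (elim CollectE exE conjE, simp)
      from sigma_sets_mono[OF this] show ?thesis
        by (subst sets_PiM_single) simp
    qed
    have "?G \<subseteq> sets path_space" by auto
    then show "sigma_sets UNIV ?G \<subseteq> sets path_space"
      using sets.sigma_sets_subset[of ?G path_space] by (simp add: space_PiM)
  qed
  show ?thesis
  proof (rule measure_eqI_generator_eq[where E = ?G and \<Omega> = UNIV and A = "\<lambda>_. path_cylinder []"])
    show "Int_stable ?G"
    proof (rule Int_stableI)
      fix X Y :: "(nat \<Rightarrow> 'v) set" assume X: "X \<in> ?G" and Y: "Y \<in> ?G"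
      show "X \<inter> Y \<in> ?G"
      proof (cases "X = {} \<or> Y = {}")
        case False
        then obtain l l' where "X = path_cylinder l" "Y = path_cylinder l'" using X Y by auto
        then show ?thesis
          using path_cylinder_Int[of l l'] path_cylinder_Int[of l' l]
          by (cases "length l \<le> length l'") (auto simp: Int_commute)
      qed auto
    qed
    show "range (\<lambda>_. path_cylinder []) \<subseteq> ?G" by blast
    show "emeasure N (path_cylinder []) \<noteq> \<infinity>" by simp
    show "(\<Union>i::nat. path_cylinder []) = (UNIV :: (nat \<Rightarrow> 'v) set)"
      by (simp add: path_cylinder_def)
    show "emeasure N X = emeasure N' X" if "X \<in> ?G" for X
      using that by (auto simp: eq)
  qed (simp_all add: N N' sets)
qed

lemma walk_kernel_Ionescu_Tulcea:
  "Ionescu_Tulcea (walk_kernel E a x) (\<lambda>_. count_space UNIV)"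
proof (rule Ionescu_Tulcea.intro)
  show "walk_kernel E a x i \<in> measurable (\<Pi>\<^sub>M n\<in>{0..<i}. count_space UNIV) (subprob_algebra (count_space UNIV))" for i
  proof (cases i)
    case 0
    then show ?thesis
      by (simp add: walk_kernel_def[abs_def] space_subprob_algebra)
  next
    case (Suc k)
    have 1: "(\<lambda>w. w k) \<in> measurable (\<Pi>\<^sub>M n\<in>{0..<Suc k}. count_space UNIV) (count_space UNIV)"
      by (rule measurable_component_singleton) simp
    have 2: "(\<lambda>y. measure_pmf (walk_step E a y)) \<in>
        measurable (count_space UNIV) (subprob_algebra (count_space UNIV))"
      by (rule measurable_measure_pmf)
    have "walk_kernel E a x (Suc k) = (\<lambda>w. measure_pmf (walk_step E a (w k)))"
      by (rule ext) (simp add: walk_kernel_def)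
    then show ?thesis using measurable_compose[OF 1 2] by (simp only: Suc)
  qed
  show "prob_space (walk_kernel E a x i w)" for i w
    by (cases i) (simp_all add: walk_kernel_def prob_space_measure_pmf)
qed

lemma sets_walk_law [measurable_cong]: "sets (walk_law E a x) = sets path_space"
proof -
  interpret Ionescu_Tulcea "walk_kernel E a x" "\<lambda>_. count_space UNIV"
    by (rule walk_kernel_Ionescu_Tulcea)
  show ?thesis unfolding walk_law_def by (rule PF.sets_lim)
qed

lemma space_walk_law [simp]: "space (walk_law E a x) = UNIV"
  using sets_eq_imp_space_eq[OF sets_walk_law, of E a x] by (simp add: space_PiM)

text \<open>
The finite-dimensional distributions. The kernel at time \<open>i\<close> only reads coordinate \<open>i - 1\<close>, so it
may be evaluated at the target path \<open>l\<close> itself.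
\<close>

lemma emeasure_walk_law_cylinder:
  "emeasure (walk_law E a x) (path_cylinder l) =
     (\<Prod>i<length l. emeasure (walk_kernel E a x i (\<lambda>k. l ! k)) {l ! i})"
proof -
  interpret Ionescu_Tulcea "walk_kernel E a x" "\<lambda>_. count_space UNIV"
    by (rule walk_kernel_Ionescu_Tulcea)
  let ?r = "\<lambda>n. restrict (\<lambda>k. l ! k) {0..<n}"
  have sing: "{?r n} \<in> sets (\<Pi>\<^sub>M n\<in>{0..<n}. count_space UNIV)" for n
  proof -
    have "(\<Pi>\<^sub>E i\<in>{0..<n}. {?r n i}) \<in> sets (\<Pi>\<^sub>M n\<in>{0..<n}. count_space UNIV)"
      by (rule sets_PiM_I_finite) auto
    then show ?thesis by (subst (asm) PiE_singleton) auto
  qed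
  have C: "emeasure (C 0 n (\<lambda>_. undefined)) {?r n} =
      (\<Prod>i<n. emeasure (walk_kernel E a x i (\<lambda>k. l ! k)) {l ! i})" for n
  proof (induction n)
    case 0
    show ?case using sing[of 0] by (simp add: emeasure_return restrict_def)
  next
    case (Suc n)
    let ?C = "C 0 n (\<lambda>_. undefined)"
    have u: "(\<lambda>_. undefined) \<in> space (\<Pi>\<^sub>M n\<in>{0..<0::nat}. count_space UNIV)"
      by (simp add: space_PiM)
    have sC: "sets ?C = sets (\<Pi>\<^sub>M n\<in>{0..<n}. count_space UNIV)"
      using sets_C[OF u, of n] by simp
    have ne: "space ?C \<noteq> {}"
      using prob_space.not_empty[OF prob_space_C[OF u]] .
    have m: "eP n \<in> measurable ?C (subprob_algebra (\<Pi>\<^sub>M n\<in>{0..<Suc n}. count_space UNIV))"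
      unfolding measurable_cong_sets[OF sC refl] by (rule measurable_eP)
    have "C 0 (Suc n) (\<lambda>_. undefined) = ?C \<bind> eP n"
      by (simp only: C.simps add_0)
    then have "emeasure (C 0 (Suc n) (\<lambda>_. undefined)) {?r (Suc n)} = (\<integral>\<^sup>+\<omega>. emeasure (eP n \<omega>) {?r (Suc n)} \<partial>?C)"
      using emeasure_bind[OF ne m sing[of "Suc n"]] by simp
    also have "\<dots> = (\<integral>\<^sup>+\<omega>. emeasure (walk_kernel E a x n (\<lambda>k. l ! k)) {l ! n} * indicator {?r n} \<omega> \<partial>?C)"
    proof (rule nn_integral_cong)
      fix \<omega> assume "\<omega> \<in> space ?C"
      then have \<omega>: "\<omega> \<in> space (\<Pi>\<^sub>M n\<in>{0..<n}. count_space UNIV)" by (simp add: space_C[OF u])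
      have ext: "\<omega> \<in> extensional {0..<n}" using \<omega> by (simp add: space_PiM PiE_iff)
      have "emeasure (eP n \<omega>) {?r (Suc n)} = walk_kernel E a x n \<omega> ((\<lambda>y. fun_upd \<omega> n y) -` {?r (Suc n)} \<inter> UNIV)"
        using emeasure_eP[OF \<omega> sing] by simp
      also have "(\<lambda>y. fun_upd \<omega> n y) -` {?r (Suc n)} \<inter> UNIV = (if \<omega> = ?r n then {l ! n} else {})"
      proof -
        have "fun_upd \<omega> n y = ?r (Suc n) \<longleftrightarrow> \<omega> = ?r n \<and> y = l ! n" for y
        proof
          assume *: "fun_upd \<omega> n y = ?r (Suc n)"
          have "\<omega> k = ?r n k" for k
            using fun_cong[OF *, of k] ext by (cases "k < n") (auto simp: extensional_def split: if_splits)
          moreover have "y = l ! n" using fun_cong[OF *, of n] by simp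
          ultimately show "\<omega> = ?r n \<and> y = l ! n" by blast
        qed (auto simp: fun_eq_iff)
        then show ?thesis by auto
      qed
      also have "walk_kernel E a x n \<omega> (if \<omega> = ?r n then {l ! n} else {}) =
        emeasure (walk_kernel E a x n (\<lambda>k. l ! k)) {l ! n} * indicator {?r n} \<omega>"
      proof (cases "\<omega> = ?r n")
        case True
        then have "walk_kernel E a x n \<omega> = walk_kernel E a x n (\<lambda>k. l ! k)"
          by (cases n) (simp_all add: walk_kernel_def)
        then show ?thesis using True by simp
      qed simp
      finally show "emeasure (eP n \<omega>) {?r (Suc n)} =
        emeasure (walk_kernel E a x n (\<lambda>k. l ! k)) {l ! n} * indicator {?r n} \<omega>" .
    qed
    also have "\<dots> = emeasure (walk_kernel E a x n (\<lambda>k. l ! k)) {l ! n} * emeasure ?C {?r n}"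
      using sing[of n] by (subst nn_integral_cmult_indicator) (auto simp: sC)
    finally show ?case by (simp only: Suc.IH prod.lessThan_Suc mult.commute)
  qed
  have "path_cylinder l = PF.emb UNIV {0..<length l} {?r (length l)}"
  proof -
    have "restrict w {0..<length l} = ?r (length l) \<longleftrightarrow> (\<forall>i<length l. w i = l ! i)" for w
      by (metis atLeastLessThan_iff le0 restrict_apply' restrict_ext)
    then show ?thesis by (auto simp: path_cylinder_def prod_emb_def)
  qed
  then have "emeasure (walk_law E a x) (path_cylinder l) =
      emeasure PF.lim (PF.emb UNIV {0..<length l} {?r (length l)})"
    by (simp only: walk_law_def)
  also have "\<dots> = emeasure (CI {0..<length l}) {?r (length l)}"
    by (rule lim[OF _ sing]) simp
  also have "\<dots> = emeasure (C 0 (length l) (\<lambda>_. undefined))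
      (PF.emb {0..<length l} {0..<length l} {?r (length l)})"
    by (rule emeasure_CI[OF subset_refl sing])
  also have "PF.emb {0..<length l} {0..<length l} {?r (length l)} = {?r (length l)}"
    by (rule prod_emb_id) (simp add: PiE_iff)
  finally show ?thesis by (simp only: C)
qed

lemma prob_space_walk_law: "prob_space (walk_law E a x)"
  using emeasure_walk_law_cylinder[of E a x "[]"]
  by (intro prob_spaceI) (simp add: path_cylinder_def)

lemma emeasure_walk_law_UNIV [simp]: "emeasure (walk_law E a x) UNIV = 1"
  using prob_space.emeasure_space_1[OF prob_space_walk_law, of E a x] by simp

lemma path_cylinder_Nil: "path_cylinder [] = UNIV"
  by (simp add: path_cylinder_def)

lemma emeasure_walk_law_Cons:
  "emeasure (walk_law E a x) (path_cylinder (b # l)) =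
     indicator {x} b * (\<Prod>i<length l. ennreal (pmf (walk_step E a ((b # l) ! i)) (l ! i)))"
proof -
  have "emeasure (walk_law E a x) (path_cylinder (b # l)) =
    emeasure (walk_kernel E a x 0 (\<lambda>k. (b # l) ! k)) {b} *
    (\<Prod>i<length l. emeasure (walk_kernel E a x (Suc i) (\<lambda>k. (b # l) ! k)) {l ! i})"
    unfolding emeasure_walk_law_cylinder by (simp add: prod.lessThan_Suc_shift del: prod.lessThan_Suc)
  then show ?thesis
    by (simp add: walk_kernel_def emeasure_pmf_single indicator_def)
qed

lemma measurable_prepend:
  "case_nat x \<in> measurable (walk_law E a y) path_space"
proof -
  have "case_nat x \<in> measurable path_space path_space"
  proof (rule measurable_PiM_single')
    show "(\<lambda>w. case_nat x w i) \<in> measurable path_space (count_space UNIV)" for i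
      by (cases i) auto
  qed auto
  then show ?thesis by (subst measurable_cong_sets[OF sets_walk_law refl])
qed

lemma walk_step_kernel_measurable:
  "(\<lambda>y. distr (walk_law E a y) path_space (case_nat x))
    \<in> measurable (measure_pmf (walk_step E a x)) (subprob_algebra path_space)"
  by (auto simp: measurable_def space_subprob_algebra
      intro!: prob_space_imp_subprob_space prob_space.prob_space_distr prob_space_walk_law measurable_prepend)

text \<open>
The Markov property at time 1, checked on cylinders: the walk from \<open>x\<close> is \<open>x\<close> followed by a walk from
a random neighbour.
\<close>

lemma walk_law_step:
  fixes x :: "'v::countable"
  shows "walk_law E a x =
    measure_pmf (walk_step E a x) \<bind> (\<lambda>y. distr (walk_law E a y) path_space (case_nat x))"
    (is "_ = ?R")
proof (rule path_measure_eqI)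
  let ?K = "\<lambda>y. distr (walk_law E a y) path_space (case_nat x)"
  show "sets ?R = sets path_space"
    by (rule sets_bind) auto
  fix l :: "'v list"
  have "emeasure ?R (path_cylinder l) = (\<integral>\<^sup>+y. emeasure (?K y) (path_cylinder l) \<partial>walk_step E a x)"
    by (rule emeasure_bind[OF _ walk_step_kernel_measurable]) auto
  also have "\<dots> = (\<integral>\<^sup>+y. emeasure (walk_law E a y) (case_nat x -` path_cylinder l) \<partial>walk_step E a x)"
    by (intro nn_integral_cong) (simp add: emeasure_distr[OF measurable_prepend])
  also have "\<dots> = emeasure (walk_law E a x) (path_cylinder l)"
  proof (cases l)
    case Nil
    then show ?thesis
      by (simp add: path_cylinder_Nil)
  next
    case (Cons b l')
    have pre: "case_nat x -` path_cylinder l = (if b = x then path_cylinder l' else {})"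
      by (auto simp: Cons path_cylinder_def less_Suc_eq_0_disj)
    show ?thesis
    proof (cases "b = x")
      case False
      then show ?thesis
        by (simp add: pre) (simp add: Cons emeasure_walk_law_Cons)
    next
      case True
      show ?thesis
      proof (cases l')
        case Nil
        then show ?thesis
          using True by (simp add: pre path_cylinder_Nil) (simp add: Cons emeasure_walk_law_Cons)
      next
        case (Cons c l'')
        have "(\<integral>\<^sup>+y. emeasure (walk_law E a y) (case_nat x -` path_cylinder l) \<partial>walk_step E a x) =
          (\<integral>\<^sup>+y. emeasure (walk_law E a c) (path_cylinder l') * indicator {c} y \<partial>walk_step E a x)"
          using True unfolding pre
          by (intro nn_integral_cong) (auto simp: Cons emeasure_walk_law_Cons indicator_def)
        also have "\<dots> = emeasure (walk_law E a c) (path_cylinder l') * pmf (walk_step E a x) c"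
          by (subst nn_integral_cmult_indicator) (auto simp: emeasure_pmf_single)
        also have "\<dots> = emeasure (walk_law E a x) (path_cylinder l)"
          unfolding \<open>l = b # l'\<close> Cons True emeasure_walk_law_Cons
          by (simp add: prod.lessThan_Suc_shift mult.commute del: prod.lessThan_Suc)
        finally show ?thesis .
      qed
    qed
  qed
  finally show "emeasure (walk_law E a x) (path_cylinder l) = emeasure ?R (path_cylinder l)" ..
qed (simp_all add: prob_space_walk_law sets_walk_law)

lemma emeasure_walk_law_step:
  fixes x :: "'v::countable"
  assumes A: "A \<in> sets path_space"
  shows "emeasure (walk_law E a x) A =
    (\<integral>\<^sup>+y. emeasure (walk_law E a y) {w. case_nat x w \<in> A} \<partial>walk_step E a x)"
proof -
  let ?K = "\<lambda>y. distr (walk_law E a y) path_space (case_nat x)"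
  have "emeasure (walk_law E a x) A = (\<integral>\<^sup>+y. emeasure (?K y) A \<partial>walk_step E a x)"
    by (subst walk_law_step, rule emeasure_bind[OF _ walk_step_kernel_measurable]) (use A in auto)
  also have "\<dots> = (\<integral>\<^sup>+y. emeasure (walk_law E a y) {w. case_nat x w \<in> A} \<partial>walk_step E a x)"
    by (intro nn_integral_cong) (simp add: emeasure_distr[OF measurable_prepend] A vimage_def)
  finally show ?thesis .
qed

lemma measurable_coordinate_pred:
  fixes n :: 'i and Q :: "'v \<Rightarrow> bool"
  shows "Measurable.pred (\<Pi>\<^sub>M i\<in>UNIV. count_space UNIV) (\<lambda>w. Q (w n))"
proof -
  have 1: "(\<lambda>w. w n) \<in> measurable (\<Pi>\<^sub>M i\<in>(UNIV :: 'i set). count_space (UNIV :: 'v set)) (count_space UNIV)"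
    by (rule measurable_component_singleton) simp
  have 2: "Measurable.pred (count_space UNIV) Q" by simp
  show ?thesis using measurable_compose[OF 1 2] .
qed

lemma measurable_coordinate_pred2:
  "Measurable.pred (path_space :: (nat \<Rightarrow> 'v::countable) measure) (\<lambda>w. Q (w m) (w n))"
proof -
  have "Measurable.pred (path_space :: (nat \<Rightarrow> 'v) measure) (\<lambda>w. \<exists>y. w m = y \<and> Q y (w n))"
    by (intro pred_intros_countable pred_intros_logic measurable_coordinate_pred)
  moreover have "(\<lambda>w. Q (w m) (w n)) = (\<lambda>w :: nat \<Rightarrow> 'v. \<exists>y. w m = y \<and> Q y (w n))" by auto
  ultimately show ?thesis by (simp only:)
qed

text \<open>
Only these instances are declared for automation: the higher-order pattern of the general forms
would match every predicate and let the search for measurability proofs diverge.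
\<close>

lemma measurable_coordinate_mem [measurable]:
  fixes Y :: "'v::countable set" and f :: "'v \<Rightarrow> nat" and z :: 'v and E :: "'v set set"
  shows "Measurable.pred path_space (\<lambda>w. w n \<in> Y)" "Measurable.pred path_space (\<lambda>w. w n = z)"
    "Measurable.pred path_space (\<lambda>w. f (w n) < k)" "Measurable.pred path_space (\<lambda>w. k < f (w n))"
    "Measurable.pred path_space (\<lambda>w. f (w n) \<le> k)" "Measurable.pred path_space (\<lambda>w. k \<le> f (w n))"
    "Measurable.pred path_space (\<lambda>w. {z, w n} \<in> E)" "Measurable.pred path_space (\<lambda>w. {w m, w n} \<in> E)"
  by (rule measurable_coordinate_pred measurable_coordinate_pred2)+

lemma path_setsI: "Measurable.pred path_space Q \<Longrightarrow> {w. Q w} \<in> sets path_space"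
  using predE[where M = path_space and P = Q] by (simp only: space_PiM space_count_space PiE_UNIV_domain UNIV_I simp_thms) simp

lemma measurable_path_shift:
  "(\<lambda>w k. w (n + k)) \<in> measurable (path_space :: (nat \<Rightarrow> 'v) measure) path_space"
  by (rule measurable_PiM_single') auto

lemma path_shift_sets:
  fixes B :: "(nat \<Rightarrow> 'v) set"
  shows "B \<in> sets path_space \<Longrightarrow> {w. (\<lambda>k. w (n + k)) \<in> B} \<in> sets path_space"
  using measurable_sets[OF measurable_path_shift[of n]] by (simp add: space_PiM vimage_def)

lemma AE_walk_start:
  fixes y :: "'v::countable"
  shows "AE w in walk_law E a y. w 0 = y"
proof -
  interpret prob_space "walk_law E a y" by (rule prob_space_walk_law)
  have "emeasure (walk_law E a y) {w. w 0 = y} = 1"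
    using emeasure_walk_law_Cons[of E a y y "[]"] by (simp add: path_cylinder_def)
  moreover have "{w. w 0 = y} \<in> sets (walk_law E a y)"
    unfolding sets_walk_law by (rule path_setsI) measurable
  ultimately show ?thesis
    using AE_in_set_eq_1[of "{w. w 0 = y}"] by (simp add: emeasure_eq_measure)
qed

text \<open>
Finite positive total weight at each vertex makes \<open>a\<^sub>y\<^sub>,\<^sub>z / \<mu>\<^sub>y\<close> a probability distribution.
\<close>

locale weighted_walk =
  fixes E :: "'v::countable set set" and a :: "'v \<Rightarrow> 'v \<Rightarrow> real"
  assumes weight: "is_weight E a"
    and finite_neighbours: "finite {z. {y, z} \<in> E}"
    and ex_neighbour: "\<exists>z. {y, z} \<in> E"
begin

abbreviation \<mu> :: "'v \<Rightarrow> real" where "\<mu> \<equiv> vertex_weight E a"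

abbreviation pr :: "'v \<Rightarrow> (nat \<Rightarrow> 'v) set \<Rightarrow> real" where
  "pr y \<equiv> measure (walk_law E a y)"

sublocale P: prob_space "walk_law E a y" for y
  by (rule prob_space_walk_law)

lemma weight_nonneg: "0 \<le> a y z" and weight_sym: "a y z = a z y"
  and weight_pos_iff: "0 < a y z \<longleftrightarrow> {y, z} \<in> E"
  using weight by (auto simp: is_weight_def)

lemma weight_eq_0: "{y, z} \<notin> E \<Longrightarrow> a y z = 0"
  using weight_pos_iff[of y z] weight_nonneg[of y z] by linarith

lemma vertex_weight_pos: "0 < \<mu> y"
proof -
  obtain z where "{y, z} \<in> E" using ex_neighbour by blast
  then show ?thesis unfolding vertex_weight_def
    by (intro sum_pos2[of _ z]) (auto simp: finite_neighbours weight_nonneg weight_pos_iff)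
qed

lemma pmf_walk_step: "pmf (walk_step E a y) z = a y z / \<mu> y"
  unfolding walk_step_def
proof (rule pmf_embed_pmf)
  show "0 \<le> a y z / \<mu> y" for z
    using weight_nonneg vertex_weight_pos[of y] by simp
  have "(\<integral>\<^sup>+ z. ennreal (a y z / \<mu> y) \<partial>count_space UNIV) = (\<Sum>z | {y, z} \<in> E. ennreal (a y z / \<mu> y))"
    using finite_neighbours[of y]
    by (intro nn_integral_count_space'[OF finite_neighbours]) (auto simp: weight_eq_0)
  also have "\<dots> = ennreal (\<Sum>z | {y, z} \<in> E. a y z / \<mu> y)"
    using weight_nonneg vertex_weight_pos[of y] by (intro sum_ennreal) auto
  also have "(\<Sum>z | {y, z} \<in> E. a y z / \<mu> y) = 1"
    using vertex_weight_pos[of y]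
    by (simp add: vertex_weight_def flip: sum_divide_distrib)
  finally show "(\<integral>\<^sup>+ z. ennreal (a y z / \<mu> y) \<partial>count_space UNIV) = 1" by simp
qed

lemma set_pmf_walk_step: "set_pmf (walk_step E a y) = {z. {y, z} \<in> E}"
  using vertex_weight_pos[of y] weight_pos_iff[of y] weight_eq_0[of y]
  by (force simp: set_pmf_iff pmf_walk_step)

text \<open>
One-step equation, multiplied by \<open>\<mu> y\<close> so that the conductances appear undivided.
\<close>

lemma pr_step:
  assumes A: "A \<in> sets path_space"
  shows "\<mu> y * pr y A = (\<Sum>z | {y, z} \<in> E. a y z * pr z {w. case_nat y w \<in> A})"
proof -
  have "ennreal (pr y A) = (\<integral>\<^sup>+z. emeasure (walk_law E a z) {w. case_nat y w \<in> A} \<partial>walk_step E a y)"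
    unfolding P.emeasure_eq_measure[symmetric] by (rule emeasure_walk_law_step[OF A])
  also have "\<dots> = (\<Sum>z | {y, z} \<in> E. ennreal (pr z {w. case_nat y w \<in> A}) * ennreal (a y z / \<mu> y))"
    using finite_neighbours[of y]
    by (subst nn_integral_measure_pmf_finite)
       (auto simp: set_pmf_walk_step pmf_walk_step P.emeasure_eq_measure)
  also have "\<dots> = ennreal (\<Sum>z | {y, z} \<in> E. pr z {w. case_nat y w \<in> A} * (a y z / \<mu> y))"
    using weight_nonneg[of y] vertex_weight_pos[of y]
    by (simp add: ennreal_mult'[symmetric] sum_ennreal flip: ennreal_mult)
  finally have "pr y A = (\<Sum>z | {y, z} \<in> E. pr z {w. case_nat y w \<in> A} * (a y z / \<mu> y))"
    using weight_nonneg[of y] vertex_weight_pos[of y]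
    by (subst (asm) ennreal_inj) (auto intro!: sum_nonneg)
  then show ?thesis
    using vertex_weight_pos[of y] by (simp add: sum_distrib_left mult.commute)
qed

lemma pr_cong_AE:
  assumes "AE w in walk_law E a y. w \<in> A \<longleftrightarrow> w \<in> B" "A \<in> sets path_space" "B \<in> sets path_space"
  shows "pr y A = pr y B"
  using assms by (intro P.finite_measure_eq_AE) (auto simp: sets_walk_law)

lemma pr_Collect_cong:
  assumes "AE w in walk_law E a y. Q w \<longleftrightarrow> R w"
    and "Measurable.pred path_space Q" "Measurable.pred path_space R"
  shows "pr y {w. Q w} = pr y {w. R w}"
  using assms(1) by (intro pr_cong_AE path_setsI assms(2,3)) (simp only: mem_Collect_eq)

text \<open>
The Markov property at time \<open>n\<close>. The past event "\<open>Y\<close> avoided before time \<open>n\<close>" covers both uses: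
\<open>Y = {}\<close> when only the position at time \<open>n\<close> matters, and \<open>Y\<close> the parent of a vertex for decompositions at a last or first
visit. Such an event is inherited by the walk after its first step, which lets the induction on \<open>n\<close>
run through \<open>pr_step\<close>.
\<close>

lemma pr_markov:
  assumes B [measurable]: "B \<in> sets path_space"
  shows "pr y {w. (\<forall>k<n. w k \<notin> Y) \<and> w n = z \<and> (\<lambda>k. w (n + k)) \<in> B} =
    pr y {w. (\<forall>k<n. w k \<notin> Y) \<and> w n = z} * pr z B"
proof (induction n arbitrary: y)
  case 0
  show ?case
  proof (cases "y = z")
    case True
    have "pr y {w. w 0 = z \<and> w \<in> B} = pr y {w. w \<in> B}"
      by (rule pr_Collect_cong, rule eventually_mono[OF AE_walk_start[of y E a]], use True in force, measurable)
    moreover have "pr y {w. w 0 = z} = pr y {w. True}"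
      by (rule pr_Collect_cong, rule eventually_mono[OF AE_walk_start[of y E a]], use True in force, measurable)
    ultimately show ?thesis
      using True P.prob_space[of y] by simp
  next
    case False
    have "pr y {w. w 0 = z \<and> w \<in> B} = pr y {w. False}"
      by (rule pr_Collect_cong, rule eventually_mono[OF AE_walk_start[of y E a]], use False in force, measurable)
    moreover have "pr y {w. w 0 = z} = pr y {w. False}"
      by (rule pr_Collect_cong, rule eventually_mono[OF AE_walk_start[of y E a]], use False in force, measurable)
    ultimately show ?thesis
      by simp
  qed
next
  case (Suc n)
  let ?A = "{w. (\<forall>k<Suc n. w k \<notin> Y) \<and> w (Suc n) = z \<and> (\<lambda>k. w (Suc n + k)) \<in> B}"
  let ?A' = "{w. (\<forall>k<Suc n. w k \<notin> Y) \<and> w (Suc n) = z}"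
  let ?C = "{w. (\<forall>k<n. w k \<notin> Y) \<and> w n = z \<and> (\<lambda>k. w (n + k)) \<in> B}"
  let ?C' = "{w. (\<forall>k<n. w k \<notin> Y) \<and> w n = z}"
  have m': "?A' \<in> sets path_space"
    by (rule path_setsI) measurable
  have m: "?A \<in> sets path_space"
  proof -
    have "?A' \<inter> {w. (\<lambda>k. w (Suc n + k)) \<in> B} \<in> sets path_space"
      by (rule sets.Int[OF m' path_shift_sets[OF B]])
    then show ?thesis by (simp add: Int_def conj_assoc)
  qed
  have "{w. case_nat y w \<in> ?A} = (if y \<in> Y then {} else ?C)"
       "{w. case_nat y w \<in> ?A'} = (if y \<in> Y then {} else ?C')"
    by (auto simp: All_less_Suc2)
  then have "\<mu> y * pr y ?A = \<mu> y * pr y ?A' * pr z B"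
    unfolding pr_step[OF m] pr_step[OF m']
    by (simp add: Suc.IH sum_distrib_right mult.assoc)
  then show ?case using vertex_weight_pos[of y] by simp
qed

lemma AE_walk_edges: "AE w in walk_law E a y. \<forall>n. {w n, w (Suc n)} \<in> E"
proof -
  have "AE w in walk_law E a y. \<not> (w n = z \<and> {z, w (Suc n)} \<notin> E)" for n z
  proof -
    let ?B = "{w. {z, w (Suc 0)} \<notin> E}"
    have B: "?B \<in> sets path_space" by (rule path_setsI) measurable
    have "\<mu> z * pr z ?B = (\<Sum>v | {z, v} \<in> E. a z v * pr v {})"
      unfolding pr_step[OF B]
    proof (intro sum.cong refl arg_cong2[where f = "(*)"])
      fix v assume "v \<in> {v. {z, v} \<in> E}"
      then have "pr v {w. {z, w 0} \<notin> E} = pr v {w. False}"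
        by (intro pr_Collect_cong, intro eventually_mono[OF AE_walk_start[of v E a]], force, measurable)
      then show "pr v {w. case_nat z w \<in> ?B} = pr v {}" by simp
    qed
    then have "pr z ?B = 0" using vertex_weight_pos[of z] by simp
    with pr_markov[OF B, of y n "{}" z]
    have "pr y {w. w n = z \<and> {z, w (Suc n)} \<notin> E} = 0" by simp
    moreover have "{w. w n = z \<and> {z, w (Suc n)} \<notin> E} \<in> sets (walk_law E a y)"
      unfolding sets_walk_law by (rule path_setsI) measurable
    ultimately show ?thesis
      by (subst AE_iff_measurable[OF _ refl]) (auto simp: P.emeasure_eq_measure)
  qed
  then have "AE w in walk_law E a y. \<forall>n z. \<not> (w n = z \<and> {z, w (Suc n)} \<notin> E)"
    unfolding AE_all_countable by blast
  then show ?thesis by (auto elim!: eventually_mono)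
qed

end

locale transient_walk = weighted_walk E a
  for E :: "'v::countable set set" and a :: "'v \<Rightarrow> 'v \<Rightarrow> real" +
  assumes transient: "transient E a"
begin

text \<open>
The events "the last visit to \<open>z\<close> is at time \<open>n\<close>" are disjoint and have probability
\<open>P\<^sub>y[X\<^sub>n = z] P\<^sub>z[no return]\<close>. The second factor is positive, so \<open>\<Sum>n. P\<^sub>y[X\<^sub>n = z]\<close>
converges and the Borel-Cantelli lemma applies.
\<close>

lemma AE_walk_finite_visits: "AE w in walk_law E a y. \<forall>z. finite {n. w n = z}"
proof -
  have "AE w in walk_law E a y. finite {n. w n = z}" for z
  proof -
    let ?B = "{w. no_return {z} w}"
    let ?F = "\<lambda>n. {w. (\<forall>k<n. w k \<notin> {}) \<and> w n = z \<and> (\<lambda>k. w (n + k)) \<in> ?B}"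
    have B: "?B \<in> sets path_space"
      unfolding no_return_def by (rule path_setsI) measurable
    have F: "?F n \<in> sets (walk_law E a y)" for n
    proof -
      have "{w. w n = z} \<inter> {w. (\<lambda>k. w (n + k)) \<in> ?B} \<in> sets path_space"
        by (intro sets.Int path_shift_sets B path_setsI) measurable
      then show ?thesis unfolding sets_walk_law by (simp add: Int_def)
    qed
    have "disjoint_family ?F"
      unfolding disjoint_family_on_def
    proof (intro ballI impI)
      have "?F m \<inter> ?F n = {}" if "m < n" for m n
      proof -
        have "n = m + (n - m)" "1 \<le> n - m" using that by auto
        then show ?thesis by (auto simp: no_return_def)
      qed
      then show "?F m \<inter> ?F n = {}" if "m \<noteq> n" for m n
        using that by (cases m n rule: linorder_cases) (auto simp: Int_commute)
    qed
    then have "summable (\<lambda>n. pr y (?F n))"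
      using P.finite_measure_UNION[of ?F y] F by (auto simp: sums_iff)
    then have "summable (\<lambda>n. pr y {w. w n = z} * pr z ?B)"
      unfolding pr_markov[OF B] by simp
    moreover have "pr z ?B > 0"
      using transient by (simp add: transient_def)
    ultimately have "summable (\<lambda>n. pr y {w. w n = z})"
      using summable_mult2[where c = "inverse (pr z ?B)"] by (fastforce simp: field_simps)
    then have "AE w in walk_law E a y. eventually (\<lambda>n. w \<in> space (walk_law E a y) - {w. w n = z}) sequentially"
      by (intro borel_cantelli_AE1) (auto simp: sets_walk_law P.emeasure_eq_measure intro!: path_setsI)
    then show ?thesis
    proof (rule eventually_mono)
      fix w assume "eventually (\<lambda>n. w \<in> space (walk_law E a y) - {w. w n = z}) sequentially"
      then obtain N where "\<forall>n\<ge>N. w n \<noteq> z" by (auto simp: eventually_sequentially)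
      then have "{n. w n = z} \<subseteq> {..<N}" by (auto simp: not_le[symmetric])
      then show "finite {n. w n = z}" by (rule finite_subset) simp
    qed
  qed
  then show ?thesis by (simp add: AE_all_countable)
qed

lemma AE_walk:
  "AE w in walk_law E a y. w 0 = y \<and> (\<forall>n. {w n, w (Suc n)} \<in> E) \<and> (\<forall>z. finite {n. w n = z})"
  using AE_walk_start AE_walk_edges AE_walk_finite_visits by eventually_elim auto

end

section \<open>Vacant set and equilibrium measure\<close>

lemma trajectories_hitting_measurable:
  fixes E :: "'v::countable set set"
  shows "trajectories_hitting E K \<in> sets (trajectory_space E)"
proof -
  have "{w \<in> space (\<Pi>\<^sub>M n\<in>(UNIV :: int set). count_space (UNIV :: 'v set)). \<exists>n. w n \<in> K}
      \<in> sets (\<Pi>\<^sub>M n\<in>UNIV. count_space UNIV)"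
    by (intro predE pred_intros_countable measurable_coordinate_pred)
  then have "{w. \<exists>n. w n \<in> K} \<in> sets (\<Pi>\<^sub>M n\<in>(UNIV :: int set). count_space (UNIV :: 'v set))"
    by (simp add: space_PiM)
  moreover have "trajectories_hitting E K = trajectories E \<inter> {w. \<exists>n. w n \<in> K}"
    by (auto simp: trajectories_hitting_def)
  ultimately show ?thesis
    unfolding trajectory_space_def sets_restrict_space by blast
qed

lemma space_trajectory_space [simp]: "space (trajectory_space E) = trajectories E"
  by (simp add: trajectory_space_def space_restrict_space space_PiM)

lemma shift_class_self: "w \<in> trajectories E \<Longrightarrow> w \<in> shift_class E w"
  by (auto simp: shift_class_def shift_rel_def intro: exI[of _ 0])

lemma range_shift: "w' \<in> shift_class E w \<Longrightarrow> range w' = range (w :: int \<Rightarrow> 'v)"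
proof -
  assume "w' \<in> shift_class E w"
  then obtain k where k: "\<And>n. w' n = w (n + k)" by (auto simp: shift_class_def shift_rel_def)
  have k': "w n = w' (n - k)" for n by (simp add: k)
  have "range w' \<subseteq> range w" by (rule image_subsetI) (simp add: k)
  moreover have "range w \<subseteq> range w'" by (rule image_subsetI) (simp only: k' rangeI)
  ultimately show ?thesis by (rule equalityI)
qed

lemma class_range_shift_class: "w \<in> trajectories E \<Longrightarrow> class_range (shift_class E w) = range w"
proof -
  assume "w \<in> trajectories E"
  then have "shift_class E w \<noteq> {}" using shift_class_self by blast
  moreover have "class_range (shift_class E w) = (\<Union>w'\<in>shift_class E w. range w)"
    unfolding class_range_def by (rule SUP_cong) (simp_all add: range_shift)
  ultimately show ?thesis by simp
qed

lemma quotient_shift_class: "c \<in> trajectories E // shift_rel E \<longleftrightarrow> (\<exists>w\<in>trajectories E. c = shift_class E w)"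
  by (auto simp: quotient_def shift_class_def)

text \<open>
Hitting \<open>K\<close> is invariant under time shift, so it is a property of the class and can be read off its range.
\<close>

lemma hitting_class_iff:
  assumes "c \<in> trajectories E // shift_rel E"
  shows "c \<in> shift_class E ` trajectories_hitting E K \<longleftrightarrow> class_range c \<inter> K \<noteq> {}"
proof -
  obtain w where w: "w \<in> trajectories E" "c = shift_class E w"
    using assms by (auto simp: quotient_shift_class)
  show ?thesis
  proof
    assume "c \<in> shift_class E ` trajectories_hitting E K"
    then obtain w' where "w' \<in> trajectories E" "c = shift_class E w'" "\<exists>n. w' n \<in> K"
      by (auto simp: trajectories_hitting_def)
    then show "class_range c \<inter> K \<noteq> {}"
      using class_range_shift_class[of w' E] by auto
  next
    assume "class_range c \<inter> K \<noteq> {}"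
    then have "w \<in> trajectories_hitting E K"
      using w class_range_shift_class[of w E] by (auto simp: trajectories_hitting_def)
    then show "c \<in> shift_class E ` trajectories_hitting E K" using w by blast
  qed
qed

lemma space_trajectory_class_space: "space (trajectory_class_space E) = trajectories E // shift_rel E"
  unfolding trajectory_class_space_def by (rule space_measure_of) auto

lemma trajectory_class_spaceI:
  assumes "A \<subseteq> trajectories E // shift_rel E" "{w \<in> trajectories E. shift_class E w \<in> A} \<in> sets (trajectory_space E)"
  shows "A \<in> sets (trajectory_class_space E)"
  unfolding trajectory_class_space_def using assms by (subst sets_measure_of) auto

lemma hitting_classes_measurable:
  fixes E :: "'v::countable set set"
  shows "shift_class E ` trajectories_hitting E K \<in> sets (trajectory_class_space E)"
proof (rule trajectory_class_spaceI)
  show "shift_class E ` trajectories_hitting E K \<subseteq> trajectories E // shift_rel E"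
    by (auto simp: quotient_shift_class trajectories_hitting_def)
  have "{w \<in> trajectories E. shift_class E w \<in> shift_class E ` trajectories_hitting E K} = trajectories_hitting E K"
  proof (intro equalityI subsetI)
    fix w assume w: "w \<in> {w \<in> trajectories E. shift_class E w \<in> shift_class E ` trajectories_hitting E K}"
    then have "class_range (shift_class E w) \<inter> K \<noteq> {}"
      using hitting_class_iff[of "shift_class E w" E K] by (auto simp: quotient_shift_class)
    then show "w \<in> trajectories_hitting E K"
      using w class_range_shift_class[of w E] by (auto simp: trajectories_hitting_def)
  qed (auto simp: trajectories_hitting_def)
  then show "{w \<in> trajectories E. shift_class E w \<in> shift_class E ` trajectories_hitting E K} \<in> sets (trajectory_space E)"
    using trajectories_hitting_measurable[of E K] by simp
qed

lemma shift_class_measurable: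
  assumes Q: "sets Q = sets (restrict_space (trajectory_space E) (trajectories_hitting E K))"
  shows "shift_class E \<in> measurable Q (trajectory_class_space E)"
proof -
  have sQ: "space Q = trajectories_hitting E K"
    using sets_eq_imp_space_eq[OF Q] by (auto simp: space_restrict_space trajectories_hitting_def)
  show ?thesis
    unfolding trajectory_class_space_def
  proof (rule measurable_measure_of)
    show "shift_class E \<in> space Q \<rightarrow> trajectories E // shift_rel E"
      by (auto simp: sQ quotient_shift_class trajectories_hitting_def)
    fix A assume A: "A \<in> {A. A \<subseteq> trajectories E // shift_rel E \<and>
           {w \<in> trajectories E. shift_class E w \<in> A} \<in> sets (trajectory_space E)}"
    have "shift_class E -` A \<inter> space Q = trajectories_hitting E K \<inter> {w \<in> trajectories E. shift_class E w \<in> A}"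
      by (auto simp: sQ trajectories_hitting_def)
    then show "shift_class E -` A \<inter> space Q \<in> sets Q"
      unfolding Q sets_restrict_space using A by auto
  qed auto
qed

lemma half_trajectories_measurable:
  "half_trajectories (E :: 'v::countable set set) \<in> sets path_space"
proof -
  have "{w. (\<forall>n. {w n, w (Suc n)} \<in> E) \<and> (\<forall>x. \<exists>m. \<forall>n. m \<le> n \<longrightarrow> w n \<noteq> x)} \<in> sets (path_space :: (nat \<Rightarrow> 'v) measure)"
    by (rule path_setsI) measurable
  moreover have "finite {n. w n = x} \<longleftrightarrow> (\<exists>m. \<forall>n. m \<le> n \<longrightarrow> w n \<noteq> x)" for w :: "nat \<Rightarrow> 'v" and x
    unfolding finite_nat_set_iff_bounded by (auto simp: not_less[symmetric])
  ultimately show ?thesis by (simp add: half_trajectories_def)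
qed

lemma half_trajectories_top: "half_trajectories E \<in> sets (half_trajectory_space E)"
proof -
  have "space (half_trajectory_space E) = half_trajectories E"
    by (simp add: half_trajectory_space_def space_restrict_space space_PiM)
  then show ?thesis using sets.top[of "half_trajectory_space E"] by simp
qed

lemma half_trajectories_of_trajectory:
  assumes w: "w \<in> trajectories E"
  shows "(\<lambda>n::nat. w (int n)) \<in> half_trajectories E" "(\<lambda>n::nat. w (- int n)) \<in> half_trajectories E"
proof -
  have e: "{w n, w (n + 1)} \<in> E" and f: "finite {n. w n = y}" for n y
    using w by (auto simp: trajectories_def)
  have "finite (int -` {n. w n = y})" "finite ((\<lambda>n. - int n) -` {n. w n = y})" for y
    by (intro finite_vimageI f; simp add: inj_def)+
  moreover have "{w (- int n), w (- int (n + 1))} \<in> E" for n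
  proof -
    have "- int (n + 1) + 1 = - int n" by simp
    then show ?thesis using e[of "- int (n + 1)"] by (simp only: insert_commute)
  qed
  moreover have "{w (int n), w (int (n + 1))} \<in> E" for n
    using e[of "int n"] by (simp add: add.commute)
  ultimately show "(\<lambda>n::nat. w (int n)) \<in> half_trajectories E" "(\<lambda>n::nat. w (- int n)) \<in> half_trajectories E"
    by (auto simp: half_trajectories_def vimage_def)
qed

context transient_walk
begin

lemma AE_half_trajectories: "AE w in walk_law E a y. w \<in> half_trajectories E"
  using AE_walk[of y] by (rule eventually_mono) (simp add: half_trajectories_def)

lemma equilibrium_measure_nonneg: "0 \<le> equilibrium_measure E a K z"
  using vertex_weight_pos[of z] by (auto simp: equilibrium_measure_def intro!: mult_nonneg_nonneg)

text \<open>
Split according to the value at time 0 and take both half-trajectory events to be all of \<open>W\<^sub>+\<close>: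
transience makes the conditional and the unconditional probability of \<open>W\<^sub>+\<close> equal to 1.
The conditional probability given an event of probability 0 has the junk value 0, which is harmless because \<open>e\<^sub>K\<close> vanishes there.
\<close>

lemma emeasure_Q:
  assumes Q: "is_Q E a K Q" and fin: "finite K"
  shows "emeasure Q (space Q) = ennreal (\<Sum>z\<in>K. equilibrium_measure E a K z)"
proof -
  let ?H = "trajectories_hitting E K"
  let ?T = "half_trajectories E"
  let ?B = "\<lambda>z. {w \<in> ?H. w 0 = z}"
  have sets_Q: "sets Q = sets (restrict_space (trajectory_space E) ?H)"
    using Q by (simp add: is_Q_def)
  have space_Q: "space Q = ?H"
    using sets_eq_imp_space_eq[OF sets_Q] by (auto simp: space_restrict_space trajectories_hitting_def)
  have B_sets: "?B z \<in> sets Q" for z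
  proof -
    have "{w \<in> space (\<Pi>\<^sub>M n\<in>(UNIV :: int set). count_space (UNIV :: 'v set)). w 0 = z}
        \<in> sets (\<Pi>\<^sub>M n\<in>UNIV. count_space UNIV)"
      by (intro predE measurable_coordinate_pred)
    then have "{w. w 0 = z} \<in> sets (\<Pi>\<^sub>M n\<in>(UNIV :: int set). count_space (UNIV :: 'v set))"
      by (simp add: space_PiM)
    then have "trajectories E \<inter> {w. w 0 = z} \<in> sets (trajectory_space E)"
      unfolding trajectory_space_def sets_restrict_space by blast
    then have "?H \<inter> (trajectories E \<inter> {w. w 0 = z}) \<in> sets Q"
      unfolding sets_Q sets_restrict_space by blast
    moreover have "?H \<inter> (trajectories E \<inter> {w. w 0 = z}) = ?B z"
      by (auto simp: trajectories_hitting_def)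
    ultimately show ?thesis by simp
  qed
  have T: "pr y ?T = 1" for y
  proof -
    have "pr y ?T = pr y UNIV"
      using AE_half_trajectories half_trajectories_measurable
      by (intro pr_cong_AE) (auto simp: space_PiM sets.top[of path_space, simplified space_PiM, simplified])
    then show ?thesis using P.prob_space[of y] by simp
  qed
  have em: "emeasure Q (?B z) = ennreal (equilibrium_measure E a K z)" for z
  proof -
    have B: "?B z = {w \<in> ?H. (\<lambda>n::nat. w (- int n)) \<in> ?T \<and> w 0 = z \<and> (\<lambda>n::nat. w (int n)) \<in> ?T}"
      using half_trajectories_of_trajectory[of _ E] by (auto simp: trajectories_hitting_def)
    have "emeasure Q (?B z) = ennreal (\<P>(w in walk_law E a z. w \<in> ?T \<bar> no_return K w)
                 * equilibrium_measure E a K z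
                 * \<P>(w in walk_law E a z. w \<in> ?T))"
      using Q half_trajectories_top[of E] unfolding B is_Q_def by blast
    also have "\<P>(w in walk_law E a z. w \<in> ?T) = 1" using T[of z] by simp
    also have "\<P>(w in walk_law E a z. w \<in> ?T \<bar> no_return K w) * equilibrium_measure E a K z =
      equilibrium_measure E a K z"
    proof (cases "equilibrium_measure E a K z = 0")
      case False
      then have "pr z {w. no_return K w} \<noteq> 0" by (auto simp: equilibrium_measure_def)
      moreover have "pr z {w. w \<in> ?T \<and> no_return K w} = pr z {w. no_return K w}"
      proof (rule pr_cong_AE)
        have nr: "{w. no_return K w} \<in> sets path_space"
          unfolding no_return_def by (rule path_setsI) measurable
        then show "{w. no_return K w} \<in> sets path_space" .
        show "{w. w \<in> ?T \<and> no_return K w} \<in> sets path_space"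
          using sets.Int[OF half_trajectories_measurable nr] by (simp add: Int_def)
        show "AE w in walk_law E a z. w \<in> {w. w \<in> ?T \<and> no_return K w} \<longleftrightarrow> w \<in> {w. no_return K w}"
          using AE_half_trajectories by (rule eventually_mono) simp
      qed
      ultimately show ?thesis by (simp add: cond_prob_def)
    qed simp
    finally show ?thesis by simp
  qed
  have "space Q = (\<Union>z. ?B z)" by (auto simp: space_Q)
  then have "emeasure Q (space Q) = (\<integral>\<^sup>+z. emeasure Q (?B z) \<partial>count_space UNIV)"
    using B_sets by (simp only:) (rule emeasure_UN_countable, auto simp: disjoint_family_on_def)
  also have "\<dots> = (\<Sum>z\<in>K. ennreal (equilibrium_measure E a K z))"
    unfolding em using fin by (intro nn_integral_count_space') (auto simp: equilibrium_measure_def)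
  also have "\<dots> = ennreal (\<Sum>z\<in>K. equilibrium_measure E a K z)"
    by (intro sum_ennreal equilibrium_measure_nonneg)
  finally show ?thesis .
qed

lemma emeasure_intensity:
  assumes \<nu>: "interlacement_intensity E a \<nu>" and fin: "finite K"
  shows "emeasure \<nu> (shift_class E ` trajectories_hitting E K) =
    ennreal (\<Sum>z\<in>K. equilibrium_measure E a K z)"
proof -
  let ?W = "shift_class E ` trajectories_hitting E K"
  have sets_\<nu>: "sets \<nu> = sets (trajectory_class_space E)"
    using \<nu> by (simp add: interlacement_intensity_def)
  have W: "?W \<in> sets \<nu>" unfolding sets_\<nu> by (rule hitting_classes_measurable)
  obtain Q where Q: "is_Q E a K Q"
    and eq: "density \<nu> (indicator ?W) = distr Q (trajectory_class_space E) (shift_class E)"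
    using \<nu> fin unfolding interlacement_intensity_def by blast
  have sets_Q: "sets Q = sets (restrict_space (trajectory_space E) (trajectories_hitting E K))"
    using Q by (simp add: is_Q_def)
  have space_Q: "space Q = trajectories_hitting E K"
    using sets_eq_imp_space_eq[OF sets_Q] by (auto simp: space_restrict_space trajectories_hitting_def)
  have "emeasure \<nu> ?W = emeasure (density \<nu> (indicator ?W)) ?W"
    using W by (subst emeasure_density) (auto simp flip: indicator_inter_arith)
  also have "\<dots> = emeasure Q (shift_class E -` ?W \<inter> space Q)"
    unfolding eq by (rule emeasure_distr[OF shift_class_measurable[OF sets_Q] hitting_classes_measurable])
  also have "shift_class E -` ?W \<inter> space Q = space Q"
    by (auto simp: space_Q)
  finally show ?thesis using emeasure_Q[OF Q fin] by simp
qed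

lemma vacant_iff_point_count:
  fixes \<omega> :: "(int \<Rightarrow> 'v) set \<times> real \<Rightarrow> nat"
  assumes supp: "{p. 0 < \<omega> p} \<subseteq> (trajectories E // shift_rel E) \<times> {0..}"
  shows "K \<subseteq> vacant_set \<omega> u \<longleftrightarrow>
    point_count \<omega> ((shift_class E ` trajectories_hitting E K) \<times> {0..u}) = 0"
proof -
  let ?W = "shift_class E ` trajectories_hitting E K"
  have "point_count \<omega> (?W \<times> {0..u}) = 0 \<longleftrightarrow> (\<forall>p\<in>?W \<times> {0..u}. \<omega> p = 0)"
    unfolding point_count_def by (subst nn_integral_0_iff_AE) (auto simp: AE_count_space)
  also have "\<dots> \<longleftrightarrow> (\<forall>c t. 0 < \<omega> (c, t) \<and> t \<le> u \<longrightarrow> class_range c \<inter> K = {})"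
  proof -
    have F: "(c, t) \<in> ?W \<times> {0..u} \<longleftrightarrow> t \<le> u \<and> class_range c \<inter> K \<noteq> {}" if "0 < \<omega> (c, t)" for c t
    proof -
      have "c \<in> trajectories E // shift_rel E" "0 \<le> t" using supp that by auto
      then show ?thesis using hitting_class_iff[of c E K] by (simp add: conj_commute)
    qed
    moreover have "(\<forall>p\<in>?W \<times> {0..u}. \<omega> p = 0) \<longleftrightarrow> (\<forall>c t. 0 < \<omega> (c, t) \<longrightarrow> (c, t) \<notin> ?W \<times> {0..u})"
      by (metis neq0_conv surj_pair less_irrefl)
    moreover have "\<dots> \<longleftrightarrow> (\<forall>c t. 0 < \<omega> (c, t) \<and> t \<le> u \<longrightarrow> class_range c \<inter> K = {})"
    proof (intro iff_allI)
      fix c t show "(0 < \<omega> (c, t) \<longrightarrow> (c, t) \<notin> ?W \<times> {0..u}) \<longleftrightarrow>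
          (0 < \<omega> (c, t) \<and> t \<le> u \<longrightarrow> class_range c \<inter> K = {})"
        using F[of c t] by argo
    qed
    ultimately show ?thesis by (simp only:)
  qed
  also have "\<dots> \<longleftrightarrow> K \<subseteq> vacant_set \<omega> u"
    by (auto simp: vacant_set_def)
  finally show ?thesis by simp
qed

text \<open>
The void probability of the Poisson process on \<open>W\<^sub>K\<^sup>* \<times> [0, u]\<close>. These
probabilities for all finite \<open>K\<close> determine the law of the vacant set.
\<close>

lemma vacant_prob:
  fixes \<omega> :: "'o \<Rightarrow> (int \<Rightarrow> 'v) set \<times> real \<Rightarrow> nat"
  assumes int: "interlacement_process E a M \<omega>" and u: "0 \<le> u" and fin: "finite K"
  shows "{\<xi>\<in>space M. K \<subseteq> vacant_set (\<omega> \<xi>) u} \<in> sets M"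
    and "measure M {\<xi>\<in>space M. K \<subseteq> vacant_set (\<omega> \<xi>) u} =
      exp (- u * (\<Sum>z\<in>K. equilibrium_measure E a K z))"
proof -
  let ?W = "shift_class E ` trajectories_hitting E K"
  let ?L = "restrict_space lborel {0::real..}"
  obtain \<nu> where \<nu>: "interlacement_intensity E a \<nu>"
    and ppp: "poisson_point_process M (\<nu> \<Otimes>\<^sub>M ?L) \<omega>"
    using int by (auto simp: interlacement_process_def)
  have sets_\<nu>: "sets \<nu> = sets (trajectory_class_space E)"
    using \<nu> by (simp add: interlacement_intensity_def)
  have space_\<nu>: "space \<nu> = trajectories E // shift_rel E"
    using sets_eq_imp_space_eq[OF sets_\<nu>] space_trajectory_class_space[of E] by simp
  have W: "?W \<in> sets \<nu>" unfolding sets_\<nu> by (rule hitting_classes_measurable)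
  have Iu: "{0..u} \<in> sets ?L" by (auto simp: sets_restrict_space_iff)
  have A: "?W \<times> {0..u} \<in> sets (\<nu> \<Otimes>\<^sub>M ?L)" using W Iu by (rule pair_measureI)
  have supp: "{p. 0 < \<omega> \<xi> p} \<subseteq> (trajectories E // shift_rel E) \<times> {0..}" if "\<xi> \<in> space M" for \<xi>
    using ppp that unfolding poisson_point_process_def
    by (auto simp: space_pair_measure space_\<nu> space_restrict_space)
  have eq: "{\<xi>\<in>space M. K \<subseteq> vacant_set (\<omega> \<xi>) u} = {\<xi>\<in>space M. point_count (\<omega> \<xi>) (?W \<times> {0..u}) = of_nat 0}"
    using vacant_iff_point_count[OF supp] by auto
  have meas: "(\<lambda>\<xi>. point_count (\<omega> \<xi>) (?W \<times> {0..u})) \<in> borel_measurable M"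
    using ppp A unfolding poisson_point_process_def by blast
  then show "{\<xi>\<in>space M. K \<subseteq> vacant_set (\<omega> \<xi>) u} \<in> sets M"
    unfolding eq by measurable
  interpret L: sigma_finite_measure ?L
    by (rule sigma_finite_measure_restrict_space) (auto intro: lborel.sigma_finite_measure_axioms)
  have "emeasure ?L {0..u} = ennreal u"
    using u by (subst emeasure_restrict_space) auto
  then have em: "emeasure (\<nu> \<Otimes>\<^sub>M ?L) (?W \<times> {0..u}) = ennreal (u * (\<Sum>z\<in>K. equilibrium_measure E a K z))"
    using L.emeasure_pair_measure_Times[OF W Iu] emeasure_intensity[OF \<nu> fin] u
    by (simp add: ennreal_mult'[symmetric] mult.commute)
  then have "measure (\<nu> \<Otimes>\<^sub>M ?L) (?W \<times> {0..u}) = u * (\<Sum>z\<in>K. equilibrium_measure E a K z)"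
    using u by (intro measure_eq_emeasure_eq_ennreal) (auto intro!: mult_nonneg_nonneg sum_nonneg equilibrium_measure_nonneg)
  moreover have "emeasure (\<nu> \<Otimes>\<^sub>M ?L) (?W \<times> {0..u}) < \<infinity>" by (simp add: em)
  then have "\<P>(\<xi> in M. point_count (\<omega> \<xi>) (?W \<times> {0..u}) = of_nat 0) =
      exp (- measure (\<nu> \<Otimes>\<^sub>M ?L) (?W \<times> {0..u})) * measure (\<nu> \<Otimes>\<^sub>M ?L) (?W \<times> {0..u}) ^ 0 / fact 0"
    using ppp A unfolding poisson_point_process_def by blast
  ultimately show "measure M {\<xi>\<in>space M. K \<subseteq> vacant_set (\<omega> \<xi>) u} =
      exp (- u * (\<Sum>z\<in>K. equilibrium_measure E a K z))"
    unfolding eq by simp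
qed

end

section \<open>Rooted trees\<close>

text \<open>
The vertex \<open>x\<close> whose cluster is studied serves as the root.
\<close>

locale rooted_tree =
  fixes E :: "'v set set" and x :: 'v
  assumes tree: "is_tree E"
begin

definition depth :: "'v \<Rightarrow> nat" where
  "depth v = graph_dist E v x"

definition child :: "'v \<Rightarrow> 'v \<Rightarrow> bool" where
  "child v c \<longleftrightarrow> {v, c} \<in> E \<and> depth c = Suc (depth v)"

lemma edge_commute: "{v, w} \<in> E \<longleftrightarrow> {w, v} \<in> E"
  by (simp add: insert_commute)

lemma edge_neq: "{v, w} \<in> E \<Longrightarrow> v \<noteq> w"
  using tree by (force simp: is_tree_def is_graph_def doubleton_eq_iff)

lemma connected_to_root: "\<exists>n. (adj E ^^ n) v x"
  using tree rtranclp_imp_relpowp[of "adj E" v x]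
  by (auto simp: is_tree_def graph_connected_def)

lemma depth_path: "(adj E ^^ depth v) v x"
  unfolding depth_def graph_dist_def by (rule LeastI_ex) (rule connected_to_root)

lemma depth_le: "(adj E ^^ n) v x \<Longrightarrow> depth v \<le> n"
  unfolding depth_def graph_dist_def by (rule Least_le)

lemma depth_root [simp]: "depth x = 0"
  using depth_le[of 0 x] by simp

lemma depth_eq_0_iff [simp]: "depth v = 0 \<longleftrightarrow> v = x"
  using depth_path[of v] by auto

lemma depth_edge_le: "{v, w} \<in> E \<Longrightarrow> depth v \<le> Suc (depth w)"
  by (rule depth_le, rule relpowp_Suc_I2[OF _ depth_path]) (simp add: adj_def)

lemma ex_parent:
  assumes "v \<noteq> x"
  shows "\<exists>p. child p v"
proof -
  obtain n where n: "depth v = Suc n"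
    using assms by (cases "depth v") auto
  have "(adj E ^^ Suc n) v x"
    using depth_path[of v] n by simp
  then obtain p where p: "adj E v p" "(adj E ^^ n) p x"
    by (rule relpowp_Suc_E2)
  have "depth p \<le> n" using p(2) by (rule depth_le)
  moreover have "depth v \<le> Suc (depth p)"
    using p(1) by (intro depth_edge_le) (simp add: adj_def)
  ultimately show ?thesis
    using n p(1) by (auto simp: child_def adj_def edge_commute)
qed

text \<open>
  Following parents upwards from two distinct vertices of equal depth until they meet gives a simple
  path between them. It has at least three vertices, so any further connection between its ends at
  larger or equal depth closes a cycle.
\<close>

lemma same_depth_path:
  assumes "depth v = n" "depth w = n" "v \<noteq> w"
  shows "\<exists>l. 3 \<le> length l \<and> distinct l \<and> successively (adj E) l \<and> hd l = v \<and> last l = w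
    \<and> (\<forall>y\<in>set l. depth y \<le> n)"
  using assms
proof (induction n arbitrary: v w)
  case 0
  then show ?case by simp
next
  case (Suc n)
  have "v \<noteq> x" "w \<noteq> x" using Suc.prems by auto
  then obtain p q where p: "child p v" and q: "child q w"
    using ex_parent by blast
  have dp: "depth p = n" "depth q = n"
    using p q Suc.prems by (auto simp: child_def)
  have av: "adj E v p" and aw: "adj E q w"
    using p q by (auto simp: child_def adj_def edge_commute)
  show ?case
  proof (cases "p = q")
    case True
    have "v \<noteq> p" "w \<noteq> p" using dp Suc.prems by auto
    then show ?thesis
      using True av aw dp Suc.prems
      by (intro exI[of _ "[v, p, w]"]) auto
  next
    case False
    from Suc.IH[OF dp False] obtain l where l: "3 \<le> length l" "distinct l" "successively (adj E) l"
      "hd l = p" "last l = q" "\<forall>y\<in>set l. depth y \<le> n" by blast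
    have "l \<noteq> []" using l(1) by auto
    have "v \<notin> set l" "w \<notin> set l" using l(6) Suc.prems by fastforce+
    moreover have "successively (adj E) (v # l @ [w])"
      using l(3-5) av aw \<open>l \<noteq> []\<close>
      by (auto simp: successively_append_iff successively_Cons)
    ultimately show ?thesis
      using l Suc.prems \<open>l \<noteq> []\<close> by (intro exI[of _ "v # l @ [w]"]) (auto simp: le_Suc_eq)
  qed
qed

lemma edge_depth:
  assumes e: "{v, w} \<in> E"
  shows "child v w \<or> child w v"
proof (rule ccontr)
  assume neg: "\<not> ?thesis"
  have "depth v \<le> Suc (depth w)" "depth w \<le> Suc (depth v)"
    using e by (auto intro: depth_edge_le simp: edge_commute)
  with neg e have "depth v = depth w"
    by (auto simp: child_def edge_commute)
  with same_depth_path[of v _ w] edge_neq[OF e] obtain l where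
    "3 \<le> length l" "distinct l" "successively (adj E) l" "hd l = v" "last l = w" by metis
  with e have "is_cycle E l" by (simp add: is_cycle_def adj_def edge_commute)
  with tree show False by (auto simp: is_tree_def)
qed

lemma parent_unique:
  assumes "child p v" "child q v"
  shows "p = q"
proof (rule ccontr)
  assume "p \<noteq> q"
  moreover have "depth p = depth q" using assms by (simp add: child_def)
  ultimately obtain l where l: "3 \<le> length l" "distinct l" "successively (adj E) l"
      "hd l = p" "last l = q" "\<forall>y\<in>set l. depth y \<le> depth q"
    using same_depth_path[of p _ q] by metis
  have "l \<noteq> []" using l(1) by auto
  moreover have "v \<notin> set l" using l(6) assms by (force simp: child_def)
  ultimately have "is_cycle E (v # l)"
    using l assms by (auto simp: is_cycle_def successively_Cons adj_def child_def edge_commute)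
  with tree show False by (auto simp: is_tree_def)
qed

lemma edge_iff_child: "{v, w} \<in> E \<longleftrightarrow> child v w \<or> child w v"
  using edge_depth by (auto simp: child_def edge_commute)

lemma child_neq_root: "child v c \<Longrightarrow> c \<noteq> x"
  by (auto simp: child_def)

definition anc :: "'v \<Rightarrow> 'v set" where
  "anc v = {z. child\<^sup>*\<^sup>* z v}"

lemma desc_depth: "child\<^sup>*\<^sup>* z v \<Longrightarrow> depth z \<le> depth v \<and> (depth z = depth v \<longrightarrow> v = z)"
  by (induction rule: rtranclp_induct) (auto simp: child_def)

lemma anc_root: "anc x = {x}"
  using desc_depth[of _ x] by (auto simp: anc_def)

lemma desc_parent:
  assumes "child\<^sup>*\<^sup>* z c" "z \<noteq> c" "child v c"
  shows "child\<^sup>*\<^sup>* z v"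
  using assms parent_unique by (metis rtranclp.cases)

lemma anc_child:
  assumes "child v c"
  shows "anc c = insert c (anc v)"
proof
  show "anc c \<subseteq> insert c (anc v)"
    using assms desc_parent by (auto simp: anc_def)
  show "insert c (anc v) \<subseteq> anc c"
    using assms by (auto simp: anc_def)
qed

lemma child_notin_anc: "child v c \<Longrightarrow> c \<notin> anc v"
  using desc_depth[of c v] by (auto simp: anc_def child_def)

lemma tree_induct [case_names root child]:
  assumes "P x" "\<And>v c. child v c \<Longrightarrow> P v \<Longrightarrow> P c"
  shows "P v"
proof (induction "depth v" arbitrary: v)
  case 0
  then show ?case using assms(1) by simp
next
  case (Suc n)
  then obtain p where "child p v" using ex_parent[of v] by force
  with Suc show ?case using assms(2) by (auto simp: child_def)
qed

lemma finite_anc: "finite (anc v)"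
  by (induction v rule: tree_induct) (auto simp: anc_root anc_child)

lemma root_in_anc: "x \<in> anc v"
  by (induction v rule: tree_induct) (auto simp: anc_root anc_child)

lemma self_in_anc: "v \<in> anc v"
  by (simp add: anc_def)

lemma parent_in_anc: "child p z \<Longrightarrow> z \<in> anc v \<Longrightarrow> p \<in> anc v"
  by (auto simp: anc_def intro: converse_rtranclp_into_rtranclp)

text \<open>
The unique simple path from the root to \<open>z\<close> consists of the ancestors of \<open>z\<close>.
\<close>

lemma cluster_root_iff: "z \<in> cluster E S x \<longleftrightarrow> anc z \<subseteq> S"
proof
  let ?R = "\<lambda>y z. y \<in> S \<and> z \<in> S \<and> {y, z} \<in> E"
  assume "z \<in> cluster E S x"
  then have "?R\<^sup>*\<^sup>* x z" and "x \<in> S" by (auto simp: cluster_def)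
  then show "anc z \<subseteq> S"
  proof (induction rule: rtranclp_induct)
    case base
    then show ?case by (simp add: anc_root)
  next
    case (step y z)
    from step.hyps(2) have "child y z \<or> child z y" by (simp add: edge_iff_child)
    then show ?case using step anc_child by auto
  qed
next
  assume "anc z \<subseteq> S"
  then show "z \<in> cluster E S x"
  proof (induction z rule: tree_induct)
    case root
    then show ?case by (auto simp: anc_root cluster_def)
  next
    case (child v c)
    have "c \<in> S" "v \<in> S" using child self_in_anc[of v] by (auto simp: anc_child)
    with child show ?case
      by (auto simp: anc_child cluster_def edge_iff_child intro: rtranclp.rtrancl_into_rtrancl)
  qed
qed

text \<open>
In a tree, the only exit from the subtree hanging below \<open>z\<close> leads to the parent of \<open>z\<close>.
\<close>

lemma path_stays_below:
  assumes p: "child p z" and z: "child\<^sup>*\<^sup>* z (w 0)"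
    and edges: "\<And>k. k < n \<Longrightarrow> {w k, w (Suc k)} \<in> E" and avoid: "\<And>k. k \<le> n \<Longrightarrow> w k \<noteq> p"
  shows "child\<^sup>*\<^sup>* z (w n)"
  using edges avoid
proof (induction n)
  case 0
  show ?case by (rule z)
next
  case (Suc n)
  then have IH: "child\<^sup>*\<^sup>* z (w n)" by auto
  have "{w n, w (Suc n)} \<in> E" using Suc.prems by auto
  then have "child (w n) (w (Suc n)) \<or> child (w (Suc n)) (w n)" by (simp add: edge_iff_child)
  then show ?case
  proof
    assume "child (w n) (w (Suc n))"
    with IH show ?thesis by auto
  next
    assume c: "child (w (Suc n)) (w n)"
    have "w n \<noteq> z" using c p parent_unique Suc.prems(2)[of "Suc n"] by auto
    with IH c show ?thesis using desc_parent by blast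
  qed
qed

lemma level_finite:
  assumes "\<And>v. finite {c. child v c}"
  shows "finite {v. depth v = n}"
proof (induction n)
  case 0
  show ?case by simp
next
  case (Suc n)
  have "{v. depth v = Suc n} = (\<Union>p\<in>{v. depth v = n}. {c. child p c})"
  proof safe
    fix v assume v: "depth v = Suc n"
    then obtain p where "child p v" using ex_parent[of v] by force
    with v show "v \<in> (\<Union>p\<in>{v. depth v = n}. {c. child p c})" by (auto simp: child_def)
  qed (auto simp: child_def)
  with Suc assms show ?case by auto
qed

lemma anc_depth:
  assumes "n \<le> depth v"
  shows "\<exists>z\<in>anc v. depth z = n"
  using assms
proof (induction v rule: tree_induct)
  case root
  then show ?case by (auto simp: anc_root)
next
  case (child v c)
  then show ?case by (cases "n = depth c") (auto simp: anc_child child_def)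
qed

lemma anc_anc: "z \<in> anc v \<Longrightarrow> anc z \<subseteq> anc v"
  by (auto simp: anc_def)

text \<open>
Levels are finite, so an infinite cluster has vertices of arbitrarily large depth, and with a vertex it
contains all its ancestors.
\<close>

lemma infinite_cluster_iff:
  assumes fin: "\<And>v. finite {c. child v c}"
  shows "infinite (cluster E S x) \<longleftrightarrow> (\<forall>n. \<exists>z. depth z = n \<and> z \<in> cluster E S x)"
proof safe
  fix n assume inf: "infinite (cluster E S x)"
  have "finite {v. depth v < n}"
  proof -
    have "{v. depth v < n} = (\<Union>k<n. {v. depth v = k})" by auto
    then show ?thesis using level_finite[OF fin] by auto
  qed
  then obtain v where "v \<in> cluster E S x" "n \<le> depth v"
    using inf by (metis (mono_tags, lifting) finite_subset mem_Collect_eq not_le subsetI)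
  then show "\<exists>z. depth z = n \<and> z \<in> cluster E S x"
    using anc_depth[of n v] anc_anc unfolding cluster_root_iff by blast
next
  assume *: "\<forall>n. \<exists>z. depth z = n \<and> z \<in> cluster E S x" and fin: "finite (cluster E S x)"
  from fin have "finite (depth ` cluster E S x)" by simp
  moreover have "depth ` cluster E S x = UNIV" using * by (auto simp: image_iff) metis
  ultimately show False by simp
qed

end

section \<open>Capacity of subtrees\<close>

locale tree_walk = rooted_tree E x + transient_walk E a
  for E :: "'v::countable set set" and x :: 'v and a :: "'v \<Rightarrow> 'v \<Rightarrow> real"
begin

text \<open>
The two probabilities in the definition of \<open>f\<^sub>x\<close>: from \<open>z\<close>, the walk descends at once and never
returns to \<open>z\<close> (\<open>q\<close>), respectively never leaves the subtree below \<open>z\<close> (\<open>h\<close>).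
\<close>

definition q :: "'v \<Rightarrow> real" where
  "q z = pr z {w. \<forall>n>0. depth z < depth (w n)}"

definition h :: "'v \<Rightarrow> real" where
  "h z = pr z {w. \<forall>n. depth z \<le> depth (w n)}"

lemma f_fun_eq: "f_fun E a x z = \<mu> z * q z * h z"
  by (simp add: f_fun_def q_def h_def depth_def)

lemma finite_children: "finite {c. child v c}"
  using finite_subset[OF _ finite_neighbours[of v], of "{c. child v c}"] by (auto simp: edge_iff_child)

lemma h_le_1: "h z \<le> 1" and h_nonneg: "0 \<le> h z" and q_nonneg: "0 \<le> q z" and q_le_1: "q z \<le> 1"
  by (simp_all add: h_def q_def)

lemma h_root: "h x = 1"
  using P.prob_space[of x] by (simp add: h_def)

lemma sum_neighbours:
  "(\<Sum>w | {v, w} \<in> E. g w) = (\<Sum>c | child v c. g c) + (\<Sum>p | child p v. g p :: real)"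
proof -
  have "{w. {v, w} \<in> E} = {c. child v c} \<union> {p. child p v}" by (auto simp: edge_iff_child)
  moreover have "finite {p. child p v}"
    using finite_subset[OF _ finite_neighbours[of v], of "{c. child c v}"] by (auto simp: edge_iff_child)
  moreover have "{c. child v c} \<inter> {p. child p v} = {}" by (auto simp: child_def)
  ultimately show ?thesis by (simp add: sum.union_disjoint finite_children)
qed

text \<open>
The first step has to lead to a child \<open>c\<close>, and from there the walk must stay in the subtree below \<open>c\<close>.
\<close>

lemma mu_q: "\<mu> z * q z = (\<Sum>c | child z c. a z c * h c)"
proof -
  let ?A = "{w. \<forall>n>0. depth z < depth (w n)}"
  have m: "?A \<in> sets path_space" by (rule path_setsI) measurable
  have pre: "{w. case_nat z w \<in> ?A} = {w. \<forall>n. depth z < depth (w n)}"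
    by (auto simp: gr0_conv_Suc)
  have c: "pr c {w. \<forall>n. depth z < depth (w n)} = h c" if "child z c" for c
    using that by (simp add: h_def child_def Suc_le_eq)
  have p: "pr p {w. \<forall>n. depth z < depth (w n)} = 0" if "child p z" for p
  proof -
    have "pr p {w. \<forall>n. depth z < depth (w n)} = pr p {w. False}"
    proof (rule pr_Collect_cong)
      show "AE w in walk_law E a p. (\<forall>n. depth z < depth (w n)) \<longleftrightarrow> False"
        using AE_walk_start[of p E a]
      proof (rule eventually_mono)
        fix w assume "w 0 = p"
        then have "\<not> depth z < depth (w 0)" using that by (simp add: child_def)
        then show "(\<forall>n. depth z < depth (w n)) \<longleftrightarrow> False" by blast
      qed
    qed measurable
    then show ?thesis by simp
  qed
  show ?thesis
    unfolding q_def pr_step[OF m] pre sum_neighbours by (simp add: c p)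
qed

lemma walk_below_or_hits_parent:
  assumes "child p z" and w: "w 0 = z" "\<And>n. {w n, w (Suc n)} \<in> E" and avoid: "\<And>k. k \<le> n \<Longrightarrow> w k \<noteq> p"
  shows "child\<^sup>*\<^sup>* z (w n)"
  using path_stays_below[of p z w n] assms by auto

lemma below_iff_avoid_parent:
  assumes p: "child p z" and w: "w 0 = z" "\<And>n. {w n, w (Suc n)} \<in> E"
  shows "(\<forall>n. depth z \<le> depth (w n)) \<longleftrightarrow> (\<forall>n. w n \<noteq> p)"
proof
  assume *: "\<forall>n. depth z \<le> depth (w n)"
  show "\<forall>n. w n \<noteq> p"
  proof
    fix n show "w n \<noteq> p" using *[rule_format, of n] p by (auto simp: child_def)
  qed
next
  assume "\<forall>n. w n \<noteq> p"
  then show "\<forall>n. depth z \<le> depth (w n)"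
    using walk_below_or_hits_parent[OF p w] desc_depth by blast
qed

text \<open>
With \<open>G\<close> the expected number of visits to \<open>z\<close> before the parent \<open>p\<close> is reached, decomposition at the
last visit to \<open>z\<close> gives \<open>h(z) = G q(z)\<close>, and decomposition at the first visit to \<open>p\<close>, which is
entered from \<open>z\<close>, gives \<open>1 - h(z) = G a\<^sub>z\<^sub>,\<^sub>p / \<mu>\<^sub>z\<close>. Eliminating \<open>G\<close> yields the identity.
\<close>

lemma h_q_balance:
  assumes p: "child p z"
  shows "\<mu> z * q z * (1 - h z) = a z p * h z"
proof -
  let ?g = "\<lambda>n. pr z {w. (\<forall>k<n. w k \<notin> {p}) \<and> w n = z}"
  let ?D = "{w :: nat \<Rightarrow> 'v. \<forall>n>0. depth z < depth (w n)}"
  let ?U = "{w :: nat \<Rightarrow> 'v. w 1 = p}"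
  let ?X = "\<lambda>B n. {w :: nat \<Rightarrow> 'v. (\<forall>k<n. w k \<notin> {p}) \<and> w n = z \<and> (\<lambda>k. w (n + k)) \<in> B}"
  have pz: "p \<noteq> z" using p by (auto simp: child_def)
  have D: "?D \<in> sets path_space" by (rule path_setsI) measurable
  have U: "?U \<in> sets path_space" by (rule path_setsI) measurable
  have X: "?X B n \<in> sets (walk_law E a z)" if B: "B \<in> sets path_space" for B n
  proof -
    have "{w. \<forall>k<n. w k \<notin> {p}} \<inter> {w. w n = z} \<inter> {w. (\<lambda>k. w (n + k)) \<in> B} \<in> sets path_space"
      by (intro sets.Int path_shift_sets B path_setsI) measurable
    then show ?thesis unfolding sets_walk_law by (simp add: Int_def conj_assoc)
  qed
  have hm: "{w. \<forall>n. depth z \<le> depth (w n)} \<in> sets path_space"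
    by (rule path_setsI) measurable
  have U_eq: "\<mu> z * pr z ?U = a z p"
  proof -
    have "pr v {w. w 0 = p} = indicator {p} v" for v
    proof (cases "v = p")
      case True
      have "pr v {w. w 0 = p} = pr v {w. True}"
        by (rule pr_Collect_cong, rule eventually_mono[OF AE_walk_start[of v E a]], use True in force, measurable)
      then show ?thesis using True P.prob_space[of v] by simp
    next
      case False
      have "pr v {w. w 0 = p} = pr v {w. False}"
        by (rule pr_Collect_cong, rule eventually_mono[OF AE_walk_start[of v E a]], use False in force, measurable)
      then show ?thesis using False by simp
    qed
    moreover have "{w. case_nat z w \<in> ?U} = {w. w 0 = p}" by auto
    ultimately have "\<mu> z * pr z ?U = (\<Sum>v | {z, v} \<in> E. a z v * indicator {p} v)"
      unfolding pr_step[OF U] by simp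
    also have "\<dots> = (\<Sum>v\<in>{p}. a z v)"
    proof (rule sum.mono_neutral_cong_right)
      show "{p} \<subseteq> {v. {z, v} \<in> E}" using p by (simp add: edge_iff_child)
    qed (auto simp: finite_neighbours)
    finally show ?thesis by simp
  qed
  \<comment> \<open>Transience provides the last visit to \<open>z\<close>; afterwards the walk avoids both \<open>z\<close> and \<open>p\<close>.\<close>
  have h_sums: "(\<lambda>n. ?g n * q z) sums h z"
  proof -
    have dis: "disjoint_family (?X ?D)"
      unfolding disjoint_family_on_def
    proof (intro ballI impI)
      have "?X ?D m \<inter> ?X ?D n = {}" if "m < n" for m n :: nat
      proof -
        have "n = m + (n - m)" "0 < n - m" using that by auto
        then show ?thesis by (auto dest!: spec[of _ "n - m"])
      qed
      then show "?X ?D m \<inter> ?X ?D n = {}" if "m \<noteq> n" for m n :: nat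
        using that by (cases m n rule: linorder_cases) (auto simp: Int_commute)
    qed
    have "pr z (\<Union>n. ?X ?D n) = h z"
      unfolding h_def
    proof (rule pr_cong_AE)
      show "(\<Union>n. ?X ?D n) \<in> sets path_space"
        using X[OF D] unfolding sets_walk_law by blast
      show "AE w in walk_law E a z. w \<in> (\<Union>n. ?X ?D n) \<longleftrightarrow> w \<in> {w. \<forall>n. depth z \<le> depth (w n)}"
        using AE_walk[of z]
      proof (rule eventually_mono)
        fix w assume "w 0 = z \<and> (\<forall>n. {w n, w (Suc n)} \<in> E) \<and> (\<forall>z. finite {n. w n = z})"
        then have w: "w 0 = z" "\<And>n. {w n, w (Suc n)} \<in> E" "finite {n. w n = z}" by auto
        show "w \<in> (\<Union>n. ?X ?D n) \<longleftrightarrow> w \<in> {w. \<forall>n. depth z \<le> depth (w n)}"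
        proof
          assume "w \<in> (\<Union>n. ?X ?D n)"
          then obtain n where n: "\<forall>k<n. w k \<noteq> p" "w n = z" "\<forall>k>0. depth z < depth (w (n + k))"
            by auto
          have "w k \<noteq> p" for k
          proof (cases "k \<le> n")
            case True
            then show ?thesis using n pz by (cases "k = n") auto
          next
            case False
            then have "depth z < depth (w k)" using n(3)[rule_format, of "k - n"] by simp
            then show ?thesis using p by (auto simp: child_def)
          qed
          then show "w \<in> {w. \<forall>n. depth z \<le> depth (w n)}"
            using below_iff_avoid_parent[OF p w(1,2)] by blast
        next
          assume below: "w \<in> {w. \<forall>n. depth z \<le> depth (w n)}"
          then have avoid: "\<And>k. w k \<noteq> p"
            using below_iff_avoid_parent[OF p w(1,2)] by blast
          define n where "n = Max {n. w n = z}"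
          have "{n. w n = z} \<noteq> {}" using w(1) by auto
          then have n: "w n = z" using Max_in[OF w(3)] by (simp add: n_def)
          have after: "w k \<noteq> z" if "n < k" for k
            using Max_ge[OF w(3), of k] that by (auto simp: n_def)
          have "depth z < depth (w (n + k))" if "k > 0" for k
            using walk_below_or_hits_parent[OF p w(1,2), of "n + k"] avoid desc_depth[of z "w (n + k)"]
              after[of "n + k"] that by fastforce
          then show "w \<in> (\<Union>n. ?X ?D n)" using n avoid by auto
        qed
      qed
    qed (rule hm)
    moreover have "(\<lambda>n. pr z (?X ?D n)) sums pr z (\<Union>n. ?X ?D n)"
      using X[OF D] dis by (intro P.finite_measure_UNION) auto
    ultimately show ?thesis
      by (simp only: pr_markov[OF D] flip: q_def)
  qed
  \<comment> \<open>The step before the first visit to \<open>p\<close> is at a neighbour of \<open>p\<close> below \<open>z\<close>, that is at \<open>z\<close>.\<close>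
  have nh_sums: "(\<lambda>n. ?g n * pr z ?U) sums (1 - h z)"
  proof -
    have dis: "disjoint_family (?X ?U)"
      unfolding disjoint_family_on_def
    proof (intro ballI impI)
      have "?X ?U m \<inter> ?X ?U n = {}" if "m < n" for m n :: nat
      proof (cases "n = Suc m")
        case False
        then have "Suc m < n" using that by simp
        then show ?thesis by auto
      qed (use pz in auto)
      then show "?X ?U m \<inter> ?X ?U n = {}" if "m \<noteq> n" for m n :: nat
        using that by (cases m n rule: linorder_cases) (auto simp: Int_commute)
    qed
    have "pr z (\<Union>n. ?X ?U n) = pr z (UNIV - {w. \<forall>n. depth z \<le> depth (w n)})"
    proof (rule pr_cong_AE)
      show "(\<Union>n. ?X ?U n) \<in> sets path_space"
        using X[OF U] unfolding sets_walk_law by blast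
      show "UNIV - {w. \<forall>n. depth z \<le> depth (w n)} \<in> sets path_space"
        using sets.Diff[OF sets.top hm] by (simp add: space_PiM)
      show "AE w in walk_law E a z. w \<in> (\<Union>n. ?X ?U n) \<longleftrightarrow> w \<in> UNIV - {w. \<forall>n. depth z \<le> depth (w n)}"
        using AE_walk[of z]
      proof (rule eventually_mono)
        fix w assume "w 0 = z \<and> (\<forall>n. {w n, w (Suc n)} \<in> E) \<and> (\<forall>z. finite {n. w n = z})"
        then have w: "w 0 = z" "\<And>n. {w n, w (Suc n)} \<in> E" by auto
        have "w \<in> (\<Union>n. ?X ?U n) \<longleftrightarrow> (\<exists>n. w n = p)"
        proof
          assume "\<exists>n. w n = p"
          define n where "n = (LEAST n. w n = p)"
          have n: "w n = p" "\<And>k. k < n \<Longrightarrow> w k \<noteq> p"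
            using LeastI_ex[OF \<open>\<exists>n. w n = p\<close>] not_less_Least by (auto simp: n_def)
          obtain m where m: "n = Suc m" using n(1) w(1) pz by (cases n) auto
          have "child\<^sup>*\<^sup>* z (w m)"
            by (rule walk_below_or_hits_parent[OF p w]) (use n m in auto)
          moreover have "child p (w m) \<or> child (w m) p"
            using w(2)[of m] n(1) m by (metis edge_iff_child)
          ultimately have "w m = z"
            using desc_depth[of z "w m"] p by (auto simp: child_def)
          with n m have "w \<in> ?X ?U m" by simp
          then show "w \<in> (\<Union>n. ?X ?U n)" by blast
        qed auto
        then show "w \<in> (\<Union>n. ?X ?U n) \<longleftrightarrow> w \<in> UNIV - {w. \<forall>n. depth z \<le> depth (w n)}"
          using below_iff_avoid_parent[OF p w] by auto
      qed
    qed
    also have "\<dots> = 1 - h z"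
      using P.prob_compl[of _ z] hm by (simp add: h_def sets_walk_law)
    finally have "pr z (\<Union>n. ?X ?U n) = 1 - h z" .
    moreover have "(\<lambda>n. pr z (?X ?U n)) sums pr z (\<Union>n. ?X ?U n)"
      using X[OF U] dis by (intro P.finite_measure_UNION) auto
    ultimately show ?thesis
      by (simp only: pr_markov[OF U])
  qed
  have "(\<lambda>n. ?g n * (q z * pr z ?U)) sums (h z * pr z ?U)"
    using sums_mult2[OF h_sums, of "pr z ?U"] by (simp add: mult.assoc)
  moreover have "(\<lambda>n. ?g n * (q z * pr z ?U)) sums ((1 - h z) * q z)"
    using sums_mult2[OF nh_sums, of "q z"] by (simp add: mult.assoc mult.commute[of "q z"])
  ultimately have "h z * pr z ?U = (1 - h z) * q z" by (rule sums_unique2)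
  then have "\<mu> z * q z * (1 - h z) = h z * (\<mu> z * pr z ?U)"
    by (metis mult.assoc mult.commute)
  then show ?thesis unfolding U_eq by (simp only: mult.commute)
qed

lemma f_fun_root: "f_fun E a x x = (\<Sum>c | child x c. a x c * h c)"
  by (simp add: f_fun_eq h_root mu_q)

lemma f_fun_child:
  assumes "child p z"
  shows "f_fun E a x z = (\<Sum>c | child z c. a z c * h c) - a p z * h z"
proof -
  have "f_fun E a x z = \<mu> z * q z - \<mu> z * q z * (1 - h z)"
    by (simp add: f_fun_eq algebra_simps)
  then show ?thesis
    using h_q_balance[OF assms] mu_q[of z] weight_sym[of p z] by simp
qed

text \<open>
From a vertex of a parent-closed set the walk avoids the set only by stepping to a child outside of it,
and the subtree below such a child is disjoint from the set.
\<close>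

lemma equilibrium_measure_eq:
  assumes K: "\<And>p c. child p c \<Longrightarrow> c \<in> K \<Longrightarrow> p \<in> K" and z: "z \<in> K"
  shows "equilibrium_measure E a K z = (\<Sum>c | child z c \<and> c \<notin> K. a z c * h c)"
proof -
  let ?A = "{w. no_return K w}"
  have m: "?A \<in> sets path_space" unfolding no_return_def by (rule path_setsI) measurable
  have pre: "{w. case_nat z w \<in> ?A} = {w. \<forall>n. w n \<notin> K}"
    by (auto simp: no_return_def Suc_le_eq gr0_conv_Suc)
  have in_K: "pr v {w. \<forall>n. w n \<notin> K} = 0" if "v \<in> K" for v
  proof -
    have "pr v {w. \<forall>n. w n \<notin> K} = pr v {w. False}"
      by (rule pr_Collect_cong, rule eventually_mono[OF AE_walk_start[of v E a]], use that in force, measurable)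
    then show ?thesis by simp
  qed
  have out: "pr c {w. \<forall>n. w n \<notin> K} = h c" if c: "child z c" "c \<notin> K" for c
    unfolding h_def
  proof (rule pr_Collect_cong)
    have below: "v \<notin> K" if "child\<^sup>*\<^sup>* c v" for v
      using that c(2) by (induction rule: rtranclp_induct) (use K in auto)
    show "AE w in walk_law E a c. (\<forall>n. w n \<notin> K) \<longleftrightarrow> (\<forall>n. depth c \<le> depth (w n))"
      using AE_walk[of c]
    proof (rule eventually_mono)
      fix w assume "w 0 = c \<and> (\<forall>n. {w n, w (Suc n)} \<in> E) \<and> (\<forall>z. finite {n. w n = z})"
      then have w: "w 0 = c" "\<And>n. {w n, w (Suc n)} \<in> E" by auto
      have "(\<forall>n. w n \<notin> K) \<longleftrightarrow> (\<forall>n. w n \<noteq> z)"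
        using z below walk_below_or_hits_parent[OF c(1) w] by metis
      then show "(\<forall>n. w n \<notin> K) \<longleftrightarrow> (\<forall>n. depth c \<le> depth (w n))"
        using below_iff_avoid_parent[OF c(1) w] by simp
    qed
  qed measurable
  have "equilibrium_measure E a K z = \<mu> z * pr z ?A"
    using z by (simp add: equilibrium_measure_def)
  also have "\<dots> = (\<Sum>c | child z c. a z c * pr c {w. \<forall>n. w n \<notin> K})"
    unfolding pr_step[OF m] pre sum_neighbours using K z in_K by simp
  also have "\<dots> = (\<Sum>c | child z c \<and> c \<notin> K. a z c * h c)"
    by (rule sum.mono_neutral_cong_right) (auto simp: finite_children in_K out)
  finally show ?thesis .
qed

definition parent :: "'v \<Rightarrow> 'v" where
  "parent c = (THE p. child p c)"

lemma parent_eq: "child p c \<Longrightarrow> parent c = p"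
  unfolding parent_def using parent_unique by blast

text \<open>
The edge term \<open>?F c\<close> of a non-root vertex \<open>c\<close> occurs with a plus sign in \<open>f\<^sub>x\<close> of its parent and
with a minus sign in \<open>f\<^sub>x(c)\<close>. In the sum over \<open>K\<close> only the edges leaving \<open>K\<close> survive, and these
make up the equilibrium measure.
\<close>

lemma capacity_eq_sum_f:
  assumes K: "\<And>p c. child p c \<Longrightarrow> c \<in> K \<Longrightarrow> p \<in> K" and fin: "finite K" and root: "x \<in> K"
  shows "(\<Sum>z\<in>K. equilibrium_measure E a K z) = (\<Sum>z\<in>K. f_fun E a x z)"
proof -
  let ?F = "\<lambda>c. a (parent c) c * h c"
  have f: "f_fun E a x z = (\<Sum>c | child z c. ?F c) - (if z = x then 0 else ?F z)" for z
  proof (cases "z = x")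
    case False
    then obtain p where "child p z" using ex_parent by blast
    then show ?thesis using False by (simp add: f_fun_child parent_eq)
  qed (simp add: f_fun_root parent_eq)
  have split: "(\<Sum>c | child z c. ?F c) =
      (\<Sum>c | child z c \<and> c \<notin> K. ?F c) + (\<Sum>c | child z c \<and> c \<in> K. ?F c)" for z
  proof -
    have "(\<Sum>c | child z c. ?F c) =
        sum ?F ({c. child z c \<and> c \<notin> K} \<union> {c. child z c \<and> c \<in> K})"
      by (rule sum.cong) auto
    also have "\<dots> = (\<Sum>c | child z c \<and> c \<notin> K. ?F c) + (\<Sum>c | child z c \<and> c \<in> K. ?F c)"
      using finite_children[of z] by (intro sum.union_disjoint) auto
    finally show ?thesis .
  qed
  have e: "equilibrium_measure E a K z = (\<Sum>c | child z c \<and> c \<notin> K. ?F c)" if "z \<in> K" for z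
  proof -
    have "equilibrium_measure E a K z = (\<Sum>c | child z c \<and> c \<notin> K. a z c * h c)"
      by (rule equilibrium_measure_eq) (use K that in auto)
    also have "\<dots> = (\<Sum>c | child z c \<and> c \<notin> K. ?F c)"
      by (rule sum.cong) (auto simp: parent_eq)
    finally show ?thesis .
  qed
  have "(\<Sum>z\<in>K. \<Sum>c | child z c \<and> c \<in> K. ?F c) = (\<Sum>c\<in>(\<Union>z\<in>K. {c. child z c \<and> c \<in> K}). ?F c)"
    using parent_unique fin by (intro sum.UNION_disjoint[symmetric]) auto
  also have "(\<Union>z\<in>K. {c. child z c \<and> c \<in> K}) = K - {x}"
  proof (intro equalityI subsetI)
    fix c assume c: "c \<in> K - {x}"
    then obtain p where "child p c" using ex_parent by blast
    then show "c \<in> (\<Union>z\<in>K. {c. child z c \<and> c \<in> K})" using c K by blast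
  qed (auto dest: child_neq_root)
  also have "(\<Sum>c\<in>K - {x}. ?F c) = (\<Sum>z\<in>K. if z = x then 0 else ?F z)"
    using fin by (intro sum.mono_neutral_cong_left) auto
  finally have "(\<Sum>z\<in>K. \<Sum>c | child z c \<and> c \<in> K. ?F c) = (\<Sum>z\<in>K. if z = x then 0 else ?F z)" .
  moreover have "(\<Sum>z\<in>K. f_fun E a x z) = (\<Sum>z\<in>K. \<Sum>c | child z c \<and> c \<notin> K. ?F c) +
      (\<Sum>z\<in>K. \<Sum>c | child z c \<and> c \<in> K. ?F c) - (\<Sum>z\<in>K. if z = x then 0 else ?F z)"
    unfolding f split by (simp only: sum.distrib sum_subtractf)
  ultimately show ?thesis by (simp add: e)
qed

end

section \<open>The law of the cluster of the root\<close>

text \<open>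
The events "all sites of \<open>K\<close> are open" are stable under intersection, and they generate the product
\<open>\<sigma>\<close>-algebra since the events of a single site do.
\<close>

lemma site_measure_eqI:
  fixes N N' :: "('v \<Rightarrow> bool) measure"
  assumes "prob_space N" and N: "sets N = sets site_space" and N': "sets N' = sets site_space"
    and eq: "\<And>K. finite K \<Longrightarrow> emeasure N {Y. \<forall>z\<in>K. Y z} = emeasure N' {Y. \<forall>z\<in>K. Y z}"
  shows "N = N'"
proof -
  interpret prob_space N by fact
  let ?G = "{{Y. \<forall>z\<in>K. Y z} | K. finite K} :: ('v \<Rightarrow> bool) set set"
  have single: "{Y. Y z} \<in> sigma_sets UNIV ?G" for z
    by (rule sigma_sets.Basic) (auto intro!: exI[of _ "{z}"])
  have *: "{Y. Y z \<in> A} \<in> sigma_sets UNIV ?G" for z and A :: "bool set"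
  proof -
    have c: "{Y. \<not> Y z} \<in> sigma_sets UNIV ?G"
      using sigma_sets.Compl[OF single[of z]] by (simp add: Compl_eq_Diff_UNIV[symmetric] Collect_neg_eq)
    have "Y z \<in> A \<longleftrightarrow> Y z \<and> True \<in> A \<or> \<not> Y z \<and> False \<in> A" for Y
      by (cases "Y z") auto
    then have "{Y. Y z \<in> A} = (if True \<in> A then {Y. Y z} else {}) \<union> (if False \<in> A then {Y. \<not> Y z} else {})"
      by auto
    also have "\<dots> \<in> sigma_sets UNIV ?G"
      using single[of z] c by (intro sigma_sets_Un) (auto intro: sigma_sets.Empty)
    finally show ?thesis .
  qed
  have meas: "{Y. \<forall>z\<in>K. Y z} \<in> sets site_space" if K: "finite K" for K :: "'v set"
  proof -
    have "{Y \<in> space (site_space :: ('v \<Rightarrow> bool) measure). \<forall>z\<in>K. Y z} \<in> sets site_space"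
      by (intro predE pred_intros_finite K) measurable
    then show ?thesis by (simp add: space_PiM)
  qed
  have sets: "sets (site_space :: ('v \<Rightarrow> bool) measure) = sigma_sets UNIV ?G"
  proof
    have "{{f \<in> UNIV \<rightarrow>\<^sub>E space (count_space UNIV). f i \<in> A} |i A.
        i \<in> UNIV \<and> A \<in> sets (count_space (UNIV :: bool set))} \<subseteq> sigma_sets UNIV ?G"
      using * by (intro subsetI) (elim CollectE exE conjE, simp)
    from sigma_sets_mono[OF this]
    show "sets (site_space :: ('v \<Rightarrow> bool) measure) \<subseteq> sigma_sets UNIV ?G"
      by (subst sets_PiM_single) simp
    have "?G \<subseteq> sets site_space" using meas by auto
    then show "sigma_sets UNIV ?G \<subseteq> sets site_space"
      using sets.sigma_sets_subset[of ?G site_space] by (simp add: space_PiM)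
  qed
  show ?thesis
  proof (rule measure_eqI_generator_eq[where E = ?G and \<Omega> = UNIV and A = "\<lambda>_. UNIV"])
    show "Int_stable ?G"
    proof (rule Int_stableI)
      fix A B assume "A \<in> ?G" "B \<in> ?G"
      then obtain K L where KL: "finite K" "finite L" "A = {Y. \<forall>z\<in>K. Y z}" "B = {Y. \<forall>z\<in>L. Y z}" by auto
      have "A \<inter> B = {Y. \<forall>z\<in>K \<union> L. Y z}" unfolding KL by auto
      then show "A \<inter> B \<in> ?G" using KL(1,2) by blast
    qed
    show "range (\<lambda>_::nat. UNIV) \<subseteq> ?G" by (auto intro!: exI[of _ "{}"])
    show "emeasure N X = emeasure N' X" if "X \<in> ?G" for X
      using that eq by auto
    show "emeasure N UNIV \<noteq> \<infinity>" by simp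
  qed (simp_all add: N N' sets)
qed

lemma pred_infinite_sites:
  "{Y :: 'v::countable \<Rightarrow> bool. infinite {z. Y z}} \<in> sets site_space"
proof -
  have "{Y \<in> space (site_space :: ('v \<Rightarrow> bool) measure). \<not> (\<exists>l::'v list. \<forall>z. Y z \<longrightarrow> z \<in> set l)} \<in> sets site_space"
    by (intro predE pred_intros_countable pred_intros_logic) measurable
  moreover have "finite {z. Y z} \<longleftrightarrow> (\<exists>l::'v list. \<forall>z. Y z \<longrightarrow> z \<in> set l)" for Y :: "'v \<Rightarrow> bool"
  proof
    assume "finite {z. Y z}"
    then obtain l where "set l = {z. Y z}" using finite_list by blast
    then show "\<exists>l. \<forall>z. Y z \<longrightarrow> z \<in> set l" by blast
  next
    assume "\<exists>l. \<forall>z. Y z \<longrightarrow> z \<in> set l"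
    then obtain l where "{z. Y z} \<subseteq> set l" by blast
    then show "finite {z. Y z}" by (rule finite_subset) simp
  qed
  ultimately show ?thesis by (simp add: space_PiM)
qed

lemma sets_bernoulli: "sets (bernoulli_site_percolation p) = sets site_space"
  unfolding bernoulli_site_percolation_def by (rule sets_PiM_cong) simp_all

lemma space_bernoulli [simp]: "space (bernoulli_site_percolation p) = UNIV"
  using sets_eq_imp_space_eq[OF sets_bernoulli[of p]] by (simp add: space_PiM)

lemma prob_space_bernoulli: "prob_space (bernoulli_site_percolation p)"
  unfolding bernoulli_site_percolation_def by (rule prob_space_PiM) (rule prob_space_measure_pmf)

lemma bernoulli_all_open:
  assumes p: "\<And>z. 0 \<le> p z" "\<And>z. p z \<le> 1" and K: "finite K"
  shows "emeasure (bernoulli_site_percolation p) {Y. \<forall>z\<in>K. Y z} = ennreal (\<Prod>z\<in>K. p z)"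
proof -
  let ?M = "\<lambda>z. measure_pmf (bernoulli_pmf (p z))"
  interpret product_prob_space ?M UNIV
    by unfold_locales
  have "emeasure (Pi\<^sub>M UNIV ?M) {Y\<in>space (Pi\<^sub>M UNIV ?M). \<forall>z\<in>K. Y z \<in> {True}} = (\<Prod>z\<in>K. emeasure (?M z) {True})"
    by (rule emeasure_PiM_Collect) (auto simp: K)
  then show ?thesis
    using p by (simp add: bernoulli_site_percolation_def space_PiM emeasure_pmf_single prod_ennreal)
qed

lemma bernoulli_all_open_measure:
  assumes p: "\<And>z. 0 \<le> p z" "\<And>z. p z \<le> 1" and K: "finite K"
  shows "measure (bernoulli_site_percolation p) {Y. \<forall>z\<in>K. Y z} = (\<Prod>z\<in>K. p z)"
  using bernoulli_all_open[OF assms] p by (intro measure_eq_emeasure_eq_ennreal prod_nonneg) auto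

text \<open>
Being unchanged under restriction to \<open>I\<close> expresses that an event depends only on the sites in \<open>I\<close>.
\<close>

lemma bernoulli_indep:
  fixes p :: "'v \<Rightarrow> real"
  assumes IJ: "I \<inter> J = {}"
    and P: "Measurable.pred (\<Pi>\<^sub>M z\<in>I. count_space UNIV) P" "\<And>Y. P (restrict Y I) = P Y"
    and Q: "Measurable.pred (\<Pi>\<^sub>M z\<in>J. count_space UNIV) Q" "\<And>Y. Q (restrict Y J) = Q Y"
  shows "measure (bernoulli_site_percolation p) {Y. P Y \<and> Q Y} =
    measure (bernoulli_site_percolation p) {Y. P Y} * measure (bernoulli_site_percolation p) {Y. Q Y}"
proof -
  let ?B = "bernoulli_site_percolation p"
  let ?C = "\<lambda>_::'v. count_space (UNIV :: bool set)"
  let ?M = "\<lambda>z. measure_pmf (bernoulli_pmf (p z))"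
  interpret PP: product_prob_space ?M UNIV
    by unfold_locales
  interpret prob_space ?B by (rule prob_space_bernoulli)
  have coord: "(\<lambda>Y. Y z) \<in> measurable ?B (?C z)" for z
    unfolding measurable_cong_sets[OF sets_bernoulli refl] by (rule measurable_component_singleton) simp
  have ind: "indep_vars ?C (\<lambda>z Y. Y z) UNIV"
  proof (subst indep_vars_iff_distr_eq_PiM)
    have d: "distr ?B (?C z) (\<lambda>Y. Y z) = ?M z" for z
    proof -
      have "distr ?B (?C z) (\<lambda>Y. Y z) = distr (Pi\<^sub>M UNIV ?M) (?M z) (\<lambda>Y. Y z)"
        unfolding bernoulli_site_percolation_def by (rule distr_cong) simp_all
      then show ?thesis using PP.PiM_component[of z] by simp
    qed
    have "distr ?B (\<Pi>\<^sub>M i\<in>UNIV. ?C i) (\<lambda>Y. \<lambda>i\<in>UNIV. Y i) = distr ?B ?B (\<lambda>Y. Y)"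
      by (rule distr_cong) (simp_all add: sets_bernoulli restrict_def)
    also have "\<dots> = ?B" by (rule distr_id)
    finally show "distr ?B (\<Pi>\<^sub>M i\<in>UNIV. ?C i) (\<lambda>Y. \<lambda>i\<in>UNIV. Y i) = (\<Pi>\<^sub>M i\<in>UNIV. distr ?B (?C i) (\<lambda>Y. Y i))"
      unfolding d by (simp add: bernoulli_site_percolation_def)
  qed (auto intro: coord)
  have "indep_var (Pi\<^sub>M I ?C) (\<lambda>\<omega>. restrict (\<lambda>i. \<omega> i) I) (Pi\<^sub>M J ?C) (\<lambda>\<omega>. restrict (\<lambda>i. \<omega> i) J)"
    by (rule indep_var_restrict[OF ind IJ]) auto
  then have "prob ((\<lambda>x. (restrict x I, restrict x J)) -` ({Y\<in>space (Pi\<^sub>M I ?C). P Y} \<times> {Y\<in>space (Pi\<^sub>M J ?C). Q Y}) \<inter> space ?B) =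
     prob ((\<lambda>x. restrict x I) -` {Y\<in>space (Pi\<^sub>M I ?C). P Y} \<inter> space ?B) *
     prob ((\<lambda>x. restrict x J) -` {Y\<in>space (Pi\<^sub>M J ?C). Q Y} \<inter> space ?B)"
    by (rule indep_varD) (intro predE P(1) Q(1))+
  moreover have "(\<lambda>x. (restrict x I, restrict x J)) -` ({Y\<in>space (Pi\<^sub>M I ?C). P Y} \<times> {Y\<in>space (Pi\<^sub>M J ?C). Q Y}) \<inter> space ?B = {Y. P Y \<and> Q Y}"
    by (auto simp: space_PiM P(2) Q(2))
  moreover have "(\<lambda>x. restrict x I) -` {Y\<in>space (Pi\<^sub>M I ?C). P Y} \<inter> space ?B = {Y. P Y}"
    by (auto simp: space_PiM P(2))
  moreover have "(\<lambda>x. restrict x J) -` {Y\<in>space (Pi\<^sub>M J ?C). Q Y} \<inter> space ?B = {Y. Q Y}"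
    by (auto simp: space_PiM Q(2))
  ultimately show ?thesis by simp
qed

context tree_walk
begin

lemma f_fun_nonneg: "0 \<le> f_fun E a x z"
  using vertex_weight_pos[of z] q_nonneg[of z] h_nonneg[of z] by (simp add: f_fun_eq)

text \<open>
The subtree spanned by \<open>K\<close> and the root. For empty \<open>K\<close> both sides are 0.
\<close>

lemma capacity_anc:
  assumes K: "finite K"
  defines "H \<equiv> (\<Union>z\<in>K. anc z)"
  shows "(\<Sum>z\<in>H. equilibrium_measure E a H z) = (\<Sum>z\<in>H. f_fun E a x z)"
proof (cases "K = {}")
  case False
  show ?thesis
  proof (rule capacity_eq_sum_f)
    show "p \<in> H" if "child p c" "c \<in> H" for p c
      using that parent_in_anc by (auto simp: H_def)
    show "x \<in> H" using False root_in_anc by (auto simp: H_def)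
    show "finite H" using K finite_anc by (auto simp: H_def)
  qed
qed (simp add: H_def)

lemma cluster_map_measurable:
  "(\<lambda>Y z. z \<in> cluster E {y. Y y} x) \<in> measurable site_space site_space"
proof (rule measurable_PiM_single')
  fix z
  have "Measurable.pred site_space (\<lambda>Y. \<forall>v\<in>anc z. Y v)"
    by (intro pred_intros_finite finite_anc) measurable
  then show "(\<lambda>Y. z \<in> cluster E {y. Y y} x) \<in> measurable site_space (count_space UNIV)"
    by (simp add: cluster_root_iff subset_eq)
qed auto

lemma vacant_map_measurable:
  assumes "interlacement_process E a M \<omega>" "0 \<le> u"
  shows "(\<lambda>\<xi> z. z \<in> cluster E (vacant_set (\<omega> \<xi>) u) x) \<in> measurable M site_space"
proof (rule measurable_PiM_single')
  fix z
  have "Measurable.pred M (\<lambda>\<xi>. anc z \<subseteq> vacant_set (\<omega> \<xi>) u)"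
    using vacant_prob(1)[OF assms finite_anc] by (simp add: pred_def)
  then show "(\<lambda>\<xi>. z \<in> cluster E (vacant_set (\<omega> \<xi>) u) x) \<in> measurable M (count_space UNIV)"
    by (simp add: cluster_root_iff)
qed auto

text \<open>
On both sides the cluster contains \<open>K\<close> iff all ancestors of \<open>K\<close> belong to the random set, an event of
probability \<open>exp(- u \<Sum>f\<^sub>x)\<close> by \<open>capacity_anc\<close> and by independence respectively.
\<close>

lemma vacant_cluster_law_eq:
  assumes int: "interlacement_process E a M \<omega>" and u: "0 \<le> u"
  shows "vacant_cluster_law E M \<omega> u x = open_cluster_law E (\<lambda>z. exp (- u * f_fun E a x z)) x"
proof (rule site_measure_eqI)
  let ?p = "\<lambda>z. exp (- u * f_fun E a x z)"
  interpret M: prob_space M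
    using int by (auto simp: interlacement_process_def poisson_point_process_def)
  have p: "0 \<le> ?p z" "?p z \<le> 1" for z
    using u f_fun_nonneg[of z] by auto
  note m1 = vacant_map_measurable[OF int u]
  have m2: "(\<lambda>Y z. z \<in> cluster E {y. Y y} x) \<in> measurable (bernoulli_site_percolation ?p) site_space"
    unfolding measurable_cong_sets[OF sets_bernoulli refl] by (rule cluster_map_measurable)
  show "prob_space (vacant_cluster_law E M \<omega> u x)"
    unfolding vacant_cluster_law_def by (rule M.prob_space_distr[OF m1])
  fix K :: "'v set" assume K: "finite K"
  let ?H = "\<Union>z\<in>K. anc z"
  have H: "finite ?H" using K finite_anc by auto
  have Y: "{Y. \<forall>z\<in>K. Y z} \<in> sets (site_space :: ('v \<Rightarrow> bool) measure)"
  proof -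
    have "{Y \<in> space (site_space :: ('v \<Rightarrow> bool) measure). \<forall>z\<in>K. Y z} \<in> sets site_space"
      by (intro predE pred_intros_finite K) measurable
    then show ?thesis by (simp add: space_PiM)
  qed
  have "emeasure (vacant_cluster_law E M \<omega> u x) {Y. \<forall>z\<in>K. Y z} =
      emeasure M {\<xi>\<in>space M. ?H \<subseteq> vacant_set (\<omega> \<xi>) u}"
    unfolding vacant_cluster_law_def emeasure_distr[OF m1 Y]
    by (rule arg_cong[where f = "emeasure M"]) (auto simp: cluster_root_iff)
  also have "\<dots> = ennreal (exp (- u * (\<Sum>z\<in>?H. f_fun E a x z)))"
    unfolding M.emeasure_eq_measure vacant_prob(2)[OF int u H] capacity_anc[OF K] ..
  also have "exp (- u * (\<Sum>z\<in>?H. f_fun E a x z)) = (\<Prod>z\<in>?H. ?p z)"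
    unfolding sum_distrib_left by (rule exp_sum[OF H])
  also have "ennreal (\<Prod>z\<in>?H. ?p z) = emeasure (bernoulli_site_percolation ?p) {Y. \<forall>z\<in>?H. Y z}"
    by (rule bernoulli_all_open[OF p H, symmetric])
  also have "\<dots> = emeasure (open_cluster_law E ?p x) {Y. \<forall>z\<in>K. Y z}"
    unfolding open_cluster_law_def emeasure_distr[OF m2 Y]
    by (rule arg_cong[where f = "emeasure (bernoulli_site_percolation ?p)"]) (auto simp: cluster_root_iff)
  finally show "emeasure (vacant_cluster_law E M \<omega> u x) {Y. \<forall>z\<in>K. Y z} =
    emeasure (open_cluster_law E ?p x) {Y. \<forall>z\<in>K. Y z}" .
qed (simp_all add: vacant_cluster_law_def open_cluster_law_def)

lemma percolation_prob_eq:
  assumes int: "interlacement_process E a M \<omega>" and u: "0 \<le> u"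
  shows "percolation_prob E M \<omega> u x =
    measure (bernoulli_site_percolation (\<lambda>z. exp (- u * f_fun E a x z))) {Y. infinite (cluster E {y. Y y} x)}"
proof -
  let ?p = "\<lambda>z. exp (- u * f_fun E a x z)"
  let ?S = "{Y :: 'v \<Rightarrow> bool. infinite {z. Y z}}"
  note m1 = vacant_map_measurable[OF int u]
  have m2: "(\<lambda>Y z. z \<in> cluster E {y. Y y} x) \<in> measurable (bernoulli_site_percolation ?p) site_space"
    unfolding measurable_cong_sets[OF sets_bernoulli refl] by (rule cluster_map_measurable)
  have "percolation_prob E M \<omega> u x = measure (vacant_cluster_law E M \<omega> u x) ?S"
    unfolding vacant_cluster_law_def measure_distr[OF m1 pred_infinite_sites] percolation_prob_def
    by (rule arg_cong[where f = "measure M"]) auto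
  also have "\<dots> = measure (open_cluster_law E ?p x) ?S"
    by (simp only: vacant_cluster_law_eq[OF int u])
  also have "\<dots> = measure (bernoulli_site_percolation ?p) {Y. infinite (cluster E {y. Y y} x)}"
    unfolding open_cluster_law_def measure_distr[OF m2 pred_infinite_sites]
    by (rule arg_cong[where f = "measure (bernoulli_site_percolation ?p)"]) auto
  finally show ?thesis .
qed

end

section \<open>Non-degeneracy of the critical value\<close>

lemma (in rooted_tree) card_neighbours: "card {z. {y, z} \<in> E} = vertex_degree E y"
proof -
  have "{e \<in> E. y \<in> e} = (\<lambda>z. {y, z}) ` {z. {y, z} \<in> E}"
  proof (intro equalityI subsetI)
    fix e assume e: "e \<in> {e \<in> E. y \<in> e}"
    then obtain v w where "e = {v, w}" using tree by (auto simp: is_tree_def is_graph_def)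
    with e show "e \<in> (\<lambda>z. {y, z}) ` {z. {y, z} \<in> E}" by (auto simp: insert_commute)
  qed auto
  moreover have "inj_on (\<lambda>z. {y, z}) {z. {y, z} \<in> E}"
    by (rule inj_onI) (auto simp: doubleton_eq_iff)
  ultimately show ?thesis by (simp add: vertex_degree_def card_image)
qed

context tree_walk
begin

lemma two_children:
  assumes deg: "3 \<le> vertex_degree E v"
  shows "\<exists>c d. child v c \<and> child v d \<and> c \<noteq> d"
proof -
  have "{w. {v, w} \<in> E} = {c. child v c} \<union> {p. child p v}" by (auto simp: edge_iff_child)
  then have "3 \<le> card ({c. child v c} \<union> {p. child p v})"
    using deg card_neighbours[of v] by simp
  also have "\<dots> \<le> card {c. child v c} + card {p. child p v}" by (rule card_Un_le)
  also have "card {p. child p v} \<le> 1"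
  proof (cases "\<exists>p. child p v")
    case True
    then obtain p where "child p v" by blast
    then have "{p. child p v} = {p}" using parent_unique by blast
    then show ?thesis by simp
  qed simp
  finally have "2 \<le> card {c. child v c}" by simp
  then obtain B where "B \<subseteq> {c. child v c}" "card B = 2" by (meson obtain_subset_with_card_n)
  then show ?thesis by (auto simp: card_2_iff)
qed

context
  fixes m m' :: real
  assumes m_pos: "0 < m" and lower: "\<And>y z. {y, z} \<in> E \<Longrightarrow> m \<le> a y z"
    and upper: "\<And>y z. {y, z} \<in> E \<Longrightarrow> a y z \<le> m'"
    and deg: "\<And>y. 3 \<le> vertex_degree E y"
begin

text \<open>
\<open>potential v\<close> is the product of the factors \<open>a / (a + m)\<close> over the edges from the root to \<open>v\<close>. The
factor is the probability of crossing an edge of conductance \<open>a\<close> upwards when the subtree below it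
is replaced by a conductance \<open>m\<close> to infinity; with two children per vertex and conductances
at least \<open>m\<close>, the true conductance to infinity is at least that large.
\<close>

definition edge_ratio :: "'v \<Rightarrow> real" where
  "edge_ratio c = a (parent c) c / (a (parent c) c + m)"

definition potential :: "'v \<Rightarrow> real" where
  "potential v = (\<Prod>c\<in>anc v - {x}. edge_ratio c)"

lemma potential_root: "potential x = 1"
  by (simp add: potential_def anc_root)

lemma potential_child:
  assumes "child v c"
  shows "potential c = potential v * (a v c / (a v c + m))"
proof -
  have "anc c - {x} = insert c (anc v - {x})"
    using assms child_neq_root[OF assms] by (auto simp: anc_child)
  then show ?thesis
    using assms child_notin_anc[OF assms] finite_anc[of v]
    by (simp add: potential_def edge_ratio_def parent_eq mult.commute)
qed

lemma potential_bounds: "0 < potential v \<and> potential v \<le> 1"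
proof (induction v rule: tree_induct)
  case root
  show ?case by (simp add: potential_root)
next
  case (child v c)
  then have "0 < a v c" by (simp add: weight_pos_iff child_def)
  then obtain r where r: "a v c / (a v c + m) = r" "0 < r" "r \<le> 1" using m_pos by auto
  show ?case
    unfolding potential_child[OF child.hyps] r(1) using child.IH r(2,3) by (simp add: mult_le_one)
qed

text \<open>
The factor \<open>a / (a + m)\<close> on the edge to the parent contributes an excess \<open>m\<close>. Each of at least two
children pays for half of it because \<open>a / (a + m) \<ge> 1 / 2\<close>.
\<close>

lemma potential_superharmonic:
  assumes "v \<noteq> x"
  shows "(\<Sum>w | {v, w} \<in> E. a v w * potential w) \<le> \<mu> v * potential v"
proof -
  obtain p where p: "child p v" using ex_parent[OF assms] by blast
  have pv: "{p'. child p' v} = {p}" using p parent_unique by blast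
  define b where "b = a p v"
  have b: "0 < b" "a v p = b"
    using p by (auto simp: b_def weight_pos_iff child_def weight_sym[of v p])
  have up: "b * potential p = (b + m) * potential v"
    unfolding potential_child[OF p] using b m_pos by (simp add: b_def field_simps)
  have pos: "0 < a v c" "m \<le> a v c" if "child v c" for c
    using that lower by (auto simp: weight_pos_iff child_def)
  have half: "1 / 2 \<le> a v c / (a v c + m)" if "child v c" for c
    using pos[OF that] m_pos by (simp add: field_simps)
  obtain c d where cd: "child v c" "child v d" "c \<noteq> d" using two_children[OF deg] by blast
  have "1 \<le> a v c / (a v c + m) + a v d / (a v d + m)"
    using half[OF cd(1)] half[OF cd(2)] by linarith
  also have "\<dots> = (\<Sum>c\<in>{c, d}. a v c / (a v c + m))"
    using cd(3) by simp
  also have "\<dots> \<le> (\<Sum>c | child v c. a v c / (a v c + m))"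
    using cd pos m_pos by (intro sum_mono2 finite_children) (auto intro!: divide_nonneg_nonneg simp: weight_nonneg)
  finally have one: "m \<le> (\<Sum>c | child v c. m * (a v c / (a v c + m)))"
    using m_pos by (simp only: sum_distrib_left[symmetric]) simp
  have "(\<Sum>c | child v c. a v c * (a v c / (a v c + m))) =
      (\<Sum>c | child v c. a v c - m * (a v c / (a v c + m)))"
  proof (rule sum.cong[OF refl])
    fix c assume "c \<in> {c. child v c}"
    then have "0 < a v c + m" using pos[of c] m_pos by simp
    then show "a v c * (a v c / (a v c + m)) = a v c - m * (a v c / (a v c + m))"
      by (simp add: field_simps)
  qed
  also have "\<dots> \<le> (\<Sum>c | child v c. a v c) - m"
    using one by (simp add: sum_subtractf)
  finally have down: "(\<Sum>c | child v c. a v c * (a v c / (a v c + m))) \<le> (\<Sum>c | child v c. a v c) - m" .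
  have "(\<Sum>w | {v, w} \<in> E. a v w * potential w) =
      (\<Sum>c | child v c. a v c * (a v c / (a v c + m))) * potential v + (b + m) * potential v"
    unfolding sum_neighbours pv using b up
    by (simp add: potential_child sum_distrib_right mult.assoc mult.left_commute[of "potential v"] mult.commute[of "potential v"])
  also have "\<dots> = ((\<Sum>c | child v c. a v c * (a v c / (a v c + m))) + (b + m)) * potential v"
    by (simp only: distrib_right)
  also have "\<dots> \<le> ((\<Sum>c | child v c. a v c) + b) * potential v"
    using down potential_bounds[of v] by (intro mult_right_mono) auto
  also have "(\<Sum>c | child v c. a v c) + b = \<mu> v"
    unfolding vertex_weight_def sum_neighbours pv using b by simp
  finally show ?thesis .
qed

text \<open>
A superharmonic function bounds hitting probabilities. At the root, where superharmonicity is not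
available, the bound is at least 1 because the potential has its maximum there.
\<close>

lemma hit_by_time_le:
  "pr v {w. \<exists>k\<le>n. w k = y} \<le> potential v / potential y"
proof (induction n arbitrary: v)
  case 0
  show ?case
  proof (cases "v = y")
    case True
    then show ?thesis using potential_bounds[of y] by simp
  next
    case False
    have "pr v {w. w 0 = y} = pr v {w. False}"
      by (rule pr_Collect_cong, rule eventually_mono[OF AE_walk_start[of v E a]], use False in force, measurable)
    then show ?thesis using potential_bounds[of v] potential_bounds[of y] by simp
  qed
next
  case (Suc n)
  let ?A = "{w. \<exists>k\<le>Suc n. w k = y}"
  show ?case
  proof (cases "v = y \<or> v = x")
    case True
    then have "1 \<le> potential v / potential y"
      using potential_bounds[of y] potential_root by (auto simp: field_simps)
    then show ?thesis using P.prob_le_1[of v ?A] by linarith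
  next
    case False
    have A: "?A \<in> sets path_space" by (rule path_setsI) measurable
    have pre: "{w. case_nat v w \<in> ?A} = {w. \<exists>k\<le>n. w k = y}"
    proof -
      have "(\<exists>k\<le>Suc n. case_nat v w k = y) \<longleftrightarrow> (\<exists>k\<le>n. w k = y)" for w
      proof
        assume "\<exists>k\<le>Suc n. case_nat v w k = y"
        then obtain k where k: "k \<le> Suc n" "case_nat v w k = y" by blast
        then show "\<exists>k\<le>n. w k = y" using False by (cases k) auto
      next
        assume "\<exists>k\<le>n. w k = y"
        then obtain k where "k \<le> n" "w k = y" by blast
        then show "\<exists>k\<le>Suc n. case_nat v w k = y" by (intro exI[of _ "Suc k"]) simp
      qed
      then show ?thesis by simp
    qed
    have "\<mu> v * pr v ?A \<le> (\<Sum>w | {v, w} \<in> E. a v w * (potential w / potential y))"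
      unfolding pr_step[OF A] pre by (intro sum_mono mult_left_mono Suc.IH weight_nonneg)
    also have "\<dots> = (\<Sum>w | {v, w} \<in> E. a v w * potential w) / potential y"
      by (simp add: sum_divide_distrib)
    also have "\<dots> \<le> \<mu> v * potential v / potential y"
      using potential_superharmonic[of v] False potential_bounds[of y] by (intro divide_right_mono) auto
    finally have "\<mu> v * pr v ?A \<le> \<mu> v * (potential v / potential y)" by simp
    then show ?thesis
      using vertex_weight_pos[of v] by (rule mult_left_le_imp_le)
  qed
qed

lemma h_lower: "m / (m' + m) \<le> h z"
proof (cases "z = x")
  case True
  obtain c where "child x c" using two_children[OF deg] by blast
  then have "m \<le> m'" using lower[of x c] upper[of x c] by (simp add: child_def)
  then show ?thesis using True h_root m_pos by simp
next
  case False
  then obtain p where p: "child p z" using ex_parent by blast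
  have e: "{p, z} \<in> E" using p by (simp add: child_def)
  have pos: "0 < a p z" "a p z \<le> m'" using e upper weight_pos_iff by auto
  let ?H = "\<lambda>n. {w. \<exists>k\<le>n. w k = p}"
  have H: "?H n \<in> sets (walk_law E a z)" for n
    unfolding sets_walk_law by (rule path_setsI) measurable
  have "incseq ?H" unfolding incseq_def by (blast intro: order_trans)
  then have "(\<lambda>n. pr z (?H n)) \<longlonglongrightarrow> pr z (\<Union>n. ?H n)"
    using H by (intro P.finite_Lim_measure_incseq) auto
  then have hit: "pr z (\<Union>n. ?H n) \<le> potential z / potential p"
    by (rule LIMSEQ_le_const2) (auto intro: hit_by_time_le)
  have "h z = pr z {w. \<not> (\<exists>n. w n = p)}"
    unfolding h_def
  proof (rule pr_Collect_cong)
    show "AE w in walk_law E a z. (\<forall>n. depth z \<le> depth (w n)) \<longleftrightarrow> \<not> (\<exists>n. w n = p)"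
      using AE_walk[of z]
    proof (rule eventually_mono)
      fix w assume "w 0 = z \<and> (\<forall>n. {w n, w (Suc n)} \<in> E) \<and> (\<forall>z. finite {n. w n = z})"
      then show "(\<forall>n. depth z \<le> depth (w n)) \<longleftrightarrow> \<not> (\<exists>n. w n = p)"
        using below_iff_avoid_parent[OF p, of w] by simp
    qed
  qed measurable
  also have "{w. \<not> (\<exists>n. w n = p)} = space (walk_law E a z) - (\<Union>n. ?H n)"
    by auto
  also have "pr z \<dots> = 1 - pr z (\<Union>n. ?H n)"
    using H by (intro P.prob_compl) blast
  finally have "1 - potential z / potential p \<le> h z" using hit by simp
  moreover have "potential z / potential p = a p z / (a p z + m)"
    using potential_child[OF p] potential_bounds[of p] by simp
  moreover have "1 - a p z / (a p z + m) = m / (a p z + m)"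
    using pos m_pos by (simp add: field_simps)
  moreover have "m / (m' + m) \<le> m / (a p z + m)"
    using pos m_pos by (intro divide_left_mono mult_pos_pos) auto
  ultimately show ?thesis by linarith
qed

text \<open>
One term of the sum in \<open>mu_q\<close> already bounds \<open>\<mu> q\<close> from below.
\<close>

lemma f_lower: "m * (m / (m' + m))\<^sup>2 \<le> f_fun E a x z"
proof -
  let ?k = "m / (m' + m)"
  obtain c where c: "child z c" using two_children[OF deg] by blast
  then have e: "{z, c} \<in> E" by (simp add: child_def)
  have k: "0 \<le> ?k" using e lower[of z c] upper[of z c] m_pos by simp
  have "m * ?k \<le> a z c * h c"
    using lower[OF e] h_lower[of c] k m_pos by (intro mult_mono) auto
  also have "\<dots> \<le> \<mu> z * q z"
    unfolding mu_q using c
    by (intro member_le_sum) (auto simp: finite_children intro!: mult_nonneg_nonneg weight_nonneg h_nonneg)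
  finally have le: "m * ?k \<le> \<mu> z * q z" .
  have "0 \<le> m * ?k" using k m_pos by (intro mult_nonneg_nonneg) auto
  then have "m * ?k * ?k \<le> \<mu> z * q z * h z"
    by (rule mult_mono'[OF le h_lower _ k])
  then show ?thesis by (simp add: f_fun_eq power2_eq_square)
qed

lemma f_upper: 
  assumes "\<And>y. vertex_degree E y \<le> D"
  shows "f_fun E a x z \<le> D * m'"
proof -
  have "f_fun E a x z \<le> \<mu> z * 1 * 1"
    unfolding f_fun_eq using vertex_weight_pos[of z] q_le_1[of z] h_le_1[of z] h_nonneg[of z] q_nonneg[of z]
    by (intro mult_mono) auto
  also have "\<mu> z \<le> of_nat (card {y. {z, y} \<in> E}) * m'"
    unfolding vertex_weight_def by (rule sum_bounded_above) (simp add: upper)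
  also have "\<dots> \<le> D * m'"
    using assms[of z] vertex_weight_pos[of z] m_pos lower upper two_children[OF deg, of z]
    unfolding card_neighbours by (intro mult_right_mono) (auto simp: child_def, force)
  finally show ?thesis by simp
qed

end

text \<open>
The expected number of cluster vertices at depth \<open>n\<close> is \<open>\<Sum>z. \<Prod>v\<in>anc z. p v\<close> over that level,
and it is at least halved from each level to the next.
\<close>

lemma subcritical_percolation:
  assumes p: "\<And>z. 0 \<le> p z" "\<And>z. p z \<le> 1" and small: "\<And>z. D * p z \<le> 1 / 2" and D: "\<And>y. vertex_degree E y \<le> D"
  shows "measure (bernoulli_site_percolation p) {Y. infinite (cluster E {y. Y y} x)} = 0"
proof -
  let ?B = "bernoulli_site_percolation p"
  interpret B: prob_space ?B by (rule prob_space_bernoulli)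
  let ?w = "\<lambda>z. \<Prod>v\<in>anc z. p v"
  let ?L = "\<lambda>n. {z. depth z = n}"
  have fin: "finite (?L n)" for n by (rule level_finite[OF finite_children])
  have w0: "0 \<le> ?w z" for z by (intro prod_nonneg) (simp add: p)
  have level: "(\<Sum>z\<in>?L n. ?w z) \<le> (1 / 2) ^ n" for n
  proof (induction n)
    case 0
    show ?case using p(2)[of x] by (simp add: anc_root)
  next
    case (Suc n)
    have "?L (Suc n) = (\<Union>v\<in>?L n. {c. child v c})"
    proof (intro equalityI subsetI)
      fix c assume c: "c \<in> ?L (Suc n)"
      then obtain v where "child v c" using ex_parent[of c] by force
      with c show "c \<in> (\<Union>v\<in>?L n. {c. child v c})" by (auto simp: child_def)
    qed (auto simp: child_def)
    then have "(\<Sum>z\<in>?L (Suc n). ?w z) = (\<Sum>v\<in>?L n. \<Sum>c | child v c. ?w c)"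
      using parent_unique by (simp only:) (rule sum.UNION_disjoint, auto simp: fin finite_children)
    also have "\<dots> \<le> (\<Sum>v\<in>?L n. ?w v * (1 / 2))"
    proof (rule sum_mono)
      fix v
      have "(\<Sum>c | child v c. ?w c) = ?w v * (\<Sum>c | child v c. p c)"
        unfolding sum_distrib_left
        by (rule sum.cong) (auto simp: anc_child child_notin_anc finite_anc mult.commute)
      also have "(\<Sum>c | child v c. p c) \<le> 1 / 2"
      proof (cases "D = 0")
        case True
        then have "card {z. {v, z} \<in> E} = 0" using D[of v] card_neighbours[of v] by simp
        then have "{c. child v c} = {}" using finite_neighbours[of v] by (auto simp: edge_iff_child)
        then show ?thesis by simp
      next
        case False
        have "(\<Sum>c | child v c. p c) \<le> (\<Sum>c | child v c. 1 / (2 * D))"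
          using small False by (intro sum_mono) (simp add: field_simps)
        also have "\<dots> = card {c. child v c} / (2 * D)" by simp
        also have "\<dots> \<le> D / (2 * D)"
        proof -
          have "card {c. child v c} \<le> card {z. {v, z} \<in> E}"
            by (rule card_mono[OF finite_neighbours]) (auto simp: edge_iff_child)
          then have "card {c. child v c} \<le> D" using D[of v] card_neighbours[of v] by simp
          then show ?thesis by (intro divide_right_mono) auto
        qed
        also have "\<dots> = 1 / 2" using False by simp
        finally show ?thesis .
      qed
      finally show "(\<Sum>c | child v c. ?w c) \<le> ?w v * (1 / 2)"
        using w0 by (simp add: mult_left_mono)
    qed
    also have "\<dots> = (\<Sum>v\<in>?L n. ?w v) / 2" by (simp add: sum_divide_distrib)
    also have "\<dots> \<le> (1 / 2) ^ Suc n" using Suc.IH by simp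
    finally show ?case .
  qed
  have meas: "{Y. \<forall>v\<in>anc z. Y v} \<in> sets ?B" for z
  proof -
    have "{Y \<in> space (site_space :: ('v \<Rightarrow> bool) measure). \<forall>v\<in>anc z. Y v} \<in> sets site_space"
      by (intro predE pred_intros_finite finite_anc) measurable
    then show ?thesis by (simp add: space_PiM sets_bernoulli)
  qed
  have bound: "measure ?B {Y. infinite (cluster E {y. Y y} x)} \<le> (1 / 2) ^ n" for n
  proof -
    have "measure ?B {Y. infinite (cluster E {y. Y y} x)} \<le> measure ?B (\<Union>z\<in>?L n. {Y. \<forall>v\<in>anc z. Y v})"
    proof (rule B.finite_measure_mono)
      show "{Y. infinite (cluster E {y. Y y} x)} \<subseteq> (\<Union>z\<in>?L n. {Y. \<forall>v\<in>anc z. Y v})"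
        unfolding infinite_cluster_iff[OF finite_children] cluster_root_iff by blast
      show "(\<Union>z\<in>?L n. {Y. \<forall>v\<in>anc z. Y v}) \<in> sets ?B"
        using meas fin by blast
    qed
    also have "\<dots> \<le> (\<Sum>z\<in>?L n. measure ?B {Y. \<forall>v\<in>anc z. Y v})"
      using meas by (intro B.finite_measure_subadditive_finite fin) auto
    also have "\<dots> = (\<Sum>z\<in>?L n. ?w z)"
      by (simp only: bernoulli_all_open_measure[OF p finite_anc])
    also have "\<dots> \<le> (1 / 2) ^ n" by (rule level)
    finally show ?thesis .
  qed
  have "(\<lambda>n. (1 / 2 :: real) ^ n) \<longlonglongrightarrow> 0" by (rule LIMSEQ_realpow_zero) auto
  then have "measure ?B {Y. infinite (cluster E {y. Y y} x)} \<le> 0"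
    by (rule LIMSEQ_le_const) (use bound in blast)
  then show ?thesis using measure_nonneg[of ?B] by (simp add: order_antisym)
qed

primrec open_descent :: "nat \<Rightarrow> 'v \<Rightarrow> ('v \<Rightarrow> bool) \<Rightarrow> bool" where
  "open_descent 0 z Y \<longleftrightarrow> Y z"
| "open_descent (Suc n) z Y \<longleftrightarrow> Y z \<and> (\<exists>c. child z c \<and> open_descent n c Y)"

definition below :: "'v \<Rightarrow> 'v set" where
  "below z = {v. child\<^sup>*\<^sup>* z v}"

lemma below_child: "child z c \<Longrightarrow> below c \<subseteq> below z"
  by (auto simp: below_def intro: converse_rtranclp_into_rtranclp)

lemma notin_below_child: "child z c \<Longrightarrow> z \<notin> below c"
  using desc_depth[of c z] by (auto simp: below_def child_def)

lemma below_disjoint: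
  assumes "child z c" "child z d" "c \<noteq> d"
  shows "below c \<inter> below d = {}"
proof -
  have same: "depth c = depth d" using assms by (simp add: child_def)
  have "\<not> child\<^sup>*\<^sup>* d v" if "child\<^sup>*\<^sup>* c v" for v
    using that
  proof (induction rule: rtranclp_induct)
    case base
    show ?case using assms(3) same desc_depth[of d c] by auto
  next
    case (step y v)
    show ?case
    proof
      assume "child\<^sup>*\<^sup>* d v"
      moreover have "d \<noteq> v"
        using desc_depth[OF step.hyps(1)] step.hyps(2) same by (auto simp: child_def)
      ultimately show False using step desc_parent by blast
    qed
  qed
  then show ?thesis by (auto simp: below_def)
qed

lemma open_descent_cong:
  "(\<And>v. v \<in> below z \<Longrightarrow> Y v = Y' v) \<Longrightarrow> open_descent n z Y \<longleftrightarrow> open_descent n z Y'"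
proof (induction n arbitrary: z)
  case 0
  then show ?case by (simp add: below_def)
next
  case (Suc n)
  have "Y z = Y' z" using Suc.prems by (simp add: below_def)
  moreover have "open_descent n c Y \<longleftrightarrow> open_descent n c Y'" if "child z c" for c
    using Suc.IH[of c] Suc.prems below_child[OF that] by blast
  ultimately show ?case by auto
qed

lemma open_descent_measurable:
  "below z \<subseteq> I \<Longrightarrow> Measurable.pred (\<Pi>\<^sub>M v\<in>I. count_space UNIV) (open_descent n z)"
proof (induction n arbitrary: z)
  case 0
  then have "z \<in> I" by (auto simp: below_def)
  then show ?case by (simp add: measurable_component_singleton)
next
  case (Suc n)
  then have z: "z \<in> I" by (auto simp: below_def)
  have child: "Measurable.pred (\<Pi>\<^sub>M v\<in>I. count_space UNIV) (\<lambda>Y. child z c \<and> open_descent n c Y)" for c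
  proof (cases "child z c")
    case True
    then show ?thesis using Suc.IH[of c] Suc.prems below_child[OF True] by auto
  qed simp
  have "Measurable.pred (\<Pi>\<^sub>M v\<in>I. count_space UNIV) (\<lambda>Y. \<exists>c. child z c \<and> open_descent n c Y)"
    by (rule pred_intros_countable) (rule child)
  moreover have "Measurable.pred (\<Pi>\<^sub>M v\<in>I. count_space UNIV) (\<lambda>Y. Y z)"
    using z by (rule measurable_component_singleton)
  ultimately show ?case
    unfolding open_descent.simps by (intro pred_intros_logic(3))
qed

lemma open_descent_antimono: "open_descent (Suc n) z Y \<Longrightarrow> open_descent n z Y"
  by (induction n arbitrary: z) auto

lemma open_descent_cluster:
  "open_descent n z Y \<Longrightarrow> anc z \<subseteq> insert z {y. Y y} \<Longrightarrow> \<exists>v. depth v = depth z + n \<and> anc v \<subseteq> {y. Y y}"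
proof (induction n arbitrary: z)
  case 0
  then show ?case by auto
next
  case (Suc n)
  then obtain c where c: "Y z" "child z c" "open_descent n c Y" by auto
  have "anc c \<subseteq> insert c {y. Y y}" using c Suc.prems(2) by (auto simp: anc_child)
  with Suc.IH[OF c(3)] obtain v where "depth v = depth c + n" "anc v \<subseteq> {y. Y y}" by blast
  then show ?case using c(2) by (auto simp: child_def)
qed

text \<open>
If \<open>s, t \<ge> 1/2\<close> are the probabilities of open descents of length \<open>n\<close> from two children, then a
descent of length \<open>n + 1\<close> has probability at least \<open>2/3 (1 - (1 - s)(1 - t)) \<ge> 1/2\<close>, by independence
of disjoint subtrees. The lower bound passes to the limit of the decreasing events.
\<close>

lemma supercritical_percolation:
  assumes p: "\<And>z. 2 / 3 \<le> p z" "\<And>z. p z \<le> 1" and deg: "\<And>y. 3 \<le> vertex_degree E y"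
  shows "1 / 2 \<le> measure (bernoulli_site_percolation p) {Y. infinite (cluster E {y. Y y} x)}"
proof -
  let ?B = "bernoulli_site_percolation p"
  interpret B: prob_space ?B by (rule prob_space_bernoulli)
  have p0: "0 \<le> p z" for z using p(1)[of z] by simp
  have single: "measure ?B {Y. Y z} = p z" for z
    using bernoulli_all_open_measure[OF p0 p(2), of "{z}"] by simp
  have od: "{Y. open_descent n z Y} \<in> sets ?B" for n z
    using open_descent_measurable[of z UNIV n] by (simp add: sets_bernoulli pred_def space_PiM)
  have half: "1 / 2 \<le> measure ?B {Y. open_descent n z Y}" for n z
  proof (induction n arbitrary: z)
    case 0
    show ?case using p(1)[of z] by (simp add: single)
  next
    case (Suc n)
    obtain c d where cd: "child z c" "child z d" "c \<noteq> d" using two_children[OF deg] by blast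
    let ?C = "\<lambda>Y. open_descent n c Y" and ?D = "\<lambda>Y. open_descent n d Y"
    have restr: "open_descent n v (restrict Y I) \<longleftrightarrow> open_descent n v Y" if "below v \<subseteq> I" for v I Y
      by (rule open_descent_cong) (use that in auto)
    have CD: "measure ?B {Y. ?C Y \<and> ?D Y} = measure ?B {Y. ?C Y} * measure ?B {Y. ?D Y}"
      by (rule bernoulli_indep[OF below_disjoint[OF cd]]) (auto intro: open_descent_measurable simp: restr)
    have zCD: "measure ?B {Y. Y z \<and> (?C Y \<or> ?D Y)} = measure ?B {Y. Y z} * measure ?B {Y. ?C Y \<or> ?D Y}"
    proof (rule bernoulli_indep[where I = "{z}" and J = "below c \<union> below d"])
      show "{z} \<inter> (below c \<union> below d) = {}" using cd notin_below_child by auto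
      show "Measurable.pred (Pi\<^sub>M (below c \<union> below d) (\<lambda>_. count_space UNIV)) (\<lambda>Y. ?C Y \<or> ?D Y)"
        by (intro pred_intros_logic open_descent_measurable) auto
    qed (auto simp: restr)
    let ?s = "measure ?B {Y. ?C Y}" and ?t = "measure ?B {Y. ?D Y}"
    have "measure ?B {Y. ?C Y \<or> ?D Y} = ?s + ?t - ?s * ?t"
    proof -
      have "measure ?B ({Y. ?C Y} \<union> {Y. ?D Y}) = ?s + ?t - measure ?B ({Y. ?C Y} \<inter> {Y. ?D Y})"
        using od by (intro measure_Un3) (auto simp: B.fmeasurable_eq_sets)
      then show ?thesis using CD by (simp add: Un_def Int_def)
    qed
    also have "\<dots> = 1 - (1 - ?s) * (1 - ?t)" by (simp add: algebra_simps)
    also have "\<dots> \<ge> 3 / 4"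
    proof -
      have "(1 - ?s) * (1 - ?t) \<le> (1 / 2) * (1 / 2)"
        using Suc.IH[of c] Suc.IH[of d] by (intro mult_mono) auto
      then show ?thesis by simp
    qed
    finally have or: "3 / 4 \<le> measure ?B {Y. ?C Y \<or> ?D Y}" .
    have "(1 / 2 :: real) \<le> (2 / 3) * (3 / 4)" by simp
    also have "\<dots> \<le> p z * measure ?B {Y. ?C Y \<or> ?D Y}"
      using p(1)[of z] or by (intro mult_mono) auto
    also have "\<dots> = measure ?B {Y. Y z \<and> (?C Y \<or> ?D Y)}" by (simp only: zCD single)
    also have "\<dots> \<le> measure ?B {Y. open_descent (Suc n) z Y}"
      using cd by (intro B.finite_measure_mono od) auto
    finally show ?case .
  qed
  have "decseq (\<lambda>n. {Y. open_descent n x Y})"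
    by (rule decseq_SucI) (use open_descent_antimono in blast)
  then have lim: "(\<lambda>n. measure ?B {Y. open_descent n x Y}) \<longlonglongrightarrow> measure ?B (\<Inter>n. {Y. open_descent n x Y})"
    using od by (intro B.finite_Lim_measure_decseq) auto
  have "1 / 2 \<le> measure ?B (\<Inter>n. {Y. open_descent n x Y})"
    using half by (intro LIMSEQ_le_const[OF lim]) blast
  also have "\<dots> \<le> measure ?B {Y. infinite (cluster E {y. Y y} x)}"
  proof (rule B.finite_measure_mono)
    show "(\<Inter>n. {Y. open_descent n x Y}) \<subseteq> {Y. infinite (cluster E {y. Y y} x)}"
    proof
      fix Y assume Y: "Y \<in> (\<Inter>n. {Y. open_descent n x Y})"
      have "\<exists>z. depth z = n \<and> z \<in> cluster E {y. Y y} x" for n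
        using open_descent_cluster[of n x Y] Y by (auto simp: anc_root cluster_root_iff)
      then show "Y \<in> {Y. infinite (cluster E {y. Y y} x)}"
        by (simp add: infinite_cluster_iff[OF finite_children])
    qed
    have "(\<lambda>Y z. z \<in> cluster E {y. Y y} x) -` {Y. infinite {z. Y z}} \<inter> space site_space \<in> sets site_space"
      by (rule measurable_sets[OF cluster_map_measurable pred_infinite_sites])
    then show "{Y. infinite (cluster E {y. Y y} x)} \<in> sets ?B"
      by (simp add: sets_bernoulli vimage_def space_PiM)
  qed
  finally show ?thesis .
qed

text \<open>
At \<open>u = ln (2 D) / lo\<close> each site is open with probability at most \<open>1 / (2 D)\<close>; for \<open>u < ln (3/2) / hi\<close>
with probability at least \<open>2/3\<close>.
\<close>

lemma critical_value_nondegenerate: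
  assumes int: "interlacement_process E a M \<omega>"
    and D: "\<And>y. vertex_degree E y \<le> D" and deg: "\<And>y. 3 \<le> vertex_degree E y"
    and m: "0 < m" and weights: "\<And>y z. {y, z} \<in> E \<Longrightarrow> m \<le> a y z \<and> a y z \<le> m'"
  shows "0 < critical_value E M \<omega> x" "critical_value E M \<omega> x < \<infinity>"
proof -
  obtain c where c: "child x c" using two_children[OF deg] by blast
  have mm': "m \<le> m'" using weights[of x c] c by (simp add: child_def)
  have D3: "3 \<le> D" using D[of x] deg[of x] by simp
  define lo where "lo = m * (m / (m' + m))\<^sup>2"
  define hi where "hi = D * m'"
  have lo: "0 < lo" "lo \<le> f_fun E a x z" for z
    using f_lower[OF m _ _ deg, of m' z] weights m mm' by (auto simp: lo_def)
  have hi: "0 < hi" "f_fun E a x z \<le> hi" for z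
    using f_upper[OF m _ _ deg D, of m' z] weights m mm' D3 by (auto simp: hi_def)
  define u1 where "u1 = ln (2 * D) / lo"
  have u1: "0 \<le> u1" using lo(1) D3 by (simp add: u1_def)
  have "percolation_prob E M \<omega> u1 x = 0"
    unfolding percolation_prob_eq[OF int u1]
  proof (rule subcritical_percolation)
    fix z
    show "exp (- u1 * f_fun E a x z) \<le> 1" using u1 f_fun_nonneg[of z] by simp
    have "ln (2 * D) \<le> u1 * f_fun E a x z"
      using mult_left_mono[OF lo(2)[of z] u1] lo(1) by (simp add: u1_def)
    then have "exp (- u1 * f_fun E a x z) \<le> exp (- ln (2 * D))" by simp
    also have "\<dots> = 1 / (2 * D)" using D3 by (simp add: exp_minus field_simps)
    finally show "D * exp (- u1 * f_fun E a x z) \<le> 1 / 2"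
      using D3 by (simp add: field_simps)
  qed (use D in auto)
  then have "critical_value E M \<omega> x \<le> ereal u1"
    unfolding critical_value_def using u1 by (intro Inf_lower) auto
  then show "critical_value E M \<omega> x < \<infinity>" by (rule order_le_less_trans) simp
  define u0 where "u0 = ln (3 / 2) / hi"
  have u0: "0 < u0" using hi(1) by (simp add: u0_def)
  have "ereal u0 \<le> critical_value E M \<omega> x"
    unfolding critical_value_def
  proof (rule Inf_greatest)
    fix e assume "e \<in> {ereal u | u. 0 \<le> u \<and> percolation_prob E M \<omega> u x = 0}"
    then obtain u where u: "e = ereal u" "0 \<le> u" "percolation_prob E M \<omega> u x = 0" by auto
    have "u0 \<le> u"
    proof (rule ccontr)
      assume "\<not> u0 \<le> u"
      then have "u < u0" by simp
      have "1 / 2 \<le> percolation_prob E M \<omega> u x"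
        unfolding percolation_prob_eq[OF int u(2)]
      proof (rule supercritical_percolation[OF _ _ deg])
        fix z
        show "exp (- u * f_fun E a x z) \<le> 1" using u(2) f_fun_nonneg[of z] by simp
        have "u * f_fun E a x z \<le> u0 * hi"
          using \<open>u < u0\<close> u(2) hi(2)[of z] hi(1) f_fun_nonneg[of z] by (intro mult_mono) auto
        also have "\<dots> = ln (3 / 2)" using hi(1) by (simp add: u0_def)
        finally have "exp (- ln (3 / 2 :: real)) \<le> exp (- u * f_fun E a x z)" by simp
        then show "2 / 3 \<le> exp (- u * f_fun E a x z)" by (simp add: exp_minus)
      qed
      then show False using u(3) by simp
    qed
    then show "ereal u0 \<le> e" using u(1) by simp
  qed
  then show "0 < critical_value E M \<omega> x"
    using u0 by (metis ereal_less(2) order_less_le_trans)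
qed

end

text \<open>
On a one-vertex graph the walk is constant, hence returns at time 1.
\<close>

lemma transient_imp_neighbour:
  assumes tree: "is_tree E" and "transient E a"
  shows "\<exists>z. {y :: 'v::countable, z} \<in> E"
proof -
  have "\<exists>z. z \<noteq> y"
  proof (rule ccontr)
    assume *: "\<nexists>z. z \<noteq> y"
    then have "\<not> no_return {y} w" for w by (auto simp: no_return_def)
    then have "{w \<in> space (walk_law E a y). no_return {y} w} = {}" by blast
    then show False using assms(2) by (metis less_irrefl measure_empty transient_def)
  qed
  then obtain z where "z \<noteq> y" by blast
  moreover have "(adj E)\<^sup>*\<^sup>* y z" using tree by (simp add: is_tree_def graph_connected_def)
  ultimately show ?thesis
    by (metis adj_def converse_rtranclpE)
qed

theorem theorem5p1:
  fixes E :: "'v::countable set set"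
    and a :: "'v \<Rightarrow> 'v \<Rightarrow> real"
    and x :: 'v
    and M :: "'o measure"
    and \<omega> :: "'o \<Rightarrow> (int \<Rightarrow> 'v) set \<times> real \<Rightarrow> nat"
  assumes tree: "is_tree E"
    and degree: "bounded_degree E"
    and weight: "is_weight E a"
    and transient: "transient E a"
    and interlacement: "interlacement_process E a M \<omega>"
  shows "(\<forall>u\<ge>0. vacant_cluster_law E M \<omega> u x =
              open_cluster_law E (\<lambda>z. exp (- u * f_fun E a x z)) x) \<and>
         ((\<forall>y. 3 \<le> vertex_degree E y) \<and>
          (\<exists>m m'. 0 < m \<and> m \<le> m' \<and> (\<forall>y z. {y, z} \<in> E \<longrightarrow> m \<le> a y z \<and> a y z \<le> m'))
          \<longrightarrow> 0 < critical_value E M \<omega> x \<and> critical_value E M \<omega> x < \<infinity>)"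
proof -
  obtain D where D: "\<And>y. finite {e \<in> E. y \<in> e}" "\<And>y. vertex_degree E y \<le> D"
    using degree by (auto simp: bounded_degree_def)
  have fin: "finite {z. {y, z} \<in> E}" for y
  proof (rule finite_imageD[where f = "\<lambda>z. {y, z}"])
    show "finite ((\<lambda>z. {y, z}) ` {z. {y, z} \<in> E})"
      by (rule finite_subset[OF _ D(1)[of y]]) auto
    show "inj_on (\<lambda>z. {y, z}) {z. {y, z} \<in> E}"
      by (rule inj_onI) (auto simp: doubleton_eq_iff)
  qed
  interpret tree_walk E x a
    by unfold_locales (use tree weight transient fin transient_imp_neighbour[OF tree transient] in auto)
  show ?thesis
  proof (intro conjI allI impI, goal_cases)
    case (1 u)
    then show ?case by (rule vacant_cluster_law_eq[OF interlacement])
  next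
    case 2
    then show ?case using critical_value_nondegenerate(1)[OF interlacement D(2)] by blast
  next
    case 3
    then show ?case using critical_value_nondegenerate(2)[OF interlacement D(2)] by blast
  qed
qed

end
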